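(* If $\phi$ satisfies (A1) and (A2), then $V(\phi,\mathbb{Z})=V(L_\phi,\mathbb{Z})$.
   Context: Fourier transform: $\widehat f(\xi)=\frac{1}{\sqrt{2\pi}}\int_{\mathbb{R}}f(x)e^{-i\xi x}\,dx$. $\mathbb{T}=[-\pi,\pi)$. $\|g\|_{W(L_\infty,\ell_1)}:=\sum_{k}\|g(\cdot+2\pi k)\|_{L_\infty(\mathbb{T})}$. A function $\phi$ satisfies (A1) if $\phi\in L_2(\mathbb{R})$ is positive definite; (A2) if $\widehat\phi\in W(L_\infty,\ell_1)$, $\inf_{\xi\in\mathbb{T}}|\widehat\phi(\xi)|>0$ and $\sum_{j\neq0}\|\widehat\phi(\cdot+2\pi j)\|_{L_\infty(\mathbb{T})}/\inf_{\xi\in\mathbb{T}}|\widehat\phi(\xi)|<\infty$. $L_\phi$ is the inverse Fourier transform of $\widehat{L_\phi}(\xi)=\frac{1}{\sqrt{2\pi}}\widehat\phi(\xi)/\sum_{j\in\mathbb{Z}}\widehat\phi(\xi+2\pi j)$. For a function $g$, $V(g,\mathbb{Z})$ is the closure in $L_2(\mathbb{R})$ of the linear span of $\{g(\cdot-j):j\in\mathbb{Z}\}$. *)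

theory Defs
  imports "HOL-Probability.Probability"
begin

definition sq_int :: "(real \<Rightarrow> complex) \<Rightarrow> bool" where
  "sq_int f \<longleftrightarrow> f \<in> borel_measurable lborel \<and> integrable lborel (\<lambda>x. (cmod (f x))\<^sup>2)"

definition l2_dist :: "(real \<Rightarrow> complex) \<Rightarrow> (real \<Rightarrow> complex) \<Rightarrow> real" where
  "l2_dist f g = sqrt (integral\<^sup>L lborel (\<lambda>x. (cmod (f x - g x))\<^sup>2))"

definition fourier_int :: "(real \<Rightarrow> complex) \<Rightarrow> real \<Rightarrow> complex" where
  "fourier_int f \<xi> = complex_of_real (1 / sqrt (2 * pi)) *
     integral\<^sup>L lborel (\<lambda>x. f x * exp (- \<i> * complex_of_real (\<xi> * x)))"

text \<open>\<open>F\<close> is (a representative of) the L2 (Plancherel) Fourier transform of \<open>f\<close>: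
  the L2 limit of the Fourier integrals of the truncations of \<open>f\<close> to [-n,n].\<close>
definition l2_fourier :: "(real \<Rightarrow> complex) \<Rightarrow> (real \<Rightarrow> complex) \<Rightarrow> bool" where
  "l2_fourier f F \<longleftrightarrow> sq_int f \<and> sq_int F \<and>
     (\<lambda>n::nat. l2_dist F (fourier_int (\<lambda>x. indicator {- real n..real n} x * f x)))
       \<longlonglongrightarrow> 0"

definition pos_def_fun :: "(real \<Rightarrow> complex) \<Rightarrow> bool" where
  "pos_def_fun \<phi> \<longleftrightarrow> (\<forall>(n::nat) (xs::nat \<Rightarrow> real) (c::nat \<Rightarrow> complex).
      let s = (\<Sum>j<n. \<Sum>k<n. c j * cnj (c k) * \<phi> (xs j - xs k)) in Im s = 0 \<and> Re s \<ge> 0)"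

definition torus :: "real set" where "torus = {-pi..<pi}"

definition loc_sup :: "(real \<Rightarrow> complex) \<Rightarrow> int \<Rightarrow> ereal" where
  "loc_sup g k = esssup (restrict_space lborel torus)
      (\<lambda>\<xi>. ereal (cmod (g (\<xi> + 2 * pi * real_of_int k))))"

text \<open>Membership in the Wiener amalgam space W(L\<infinity>, l1).\<close>
definition in_W :: "(real \<Rightarrow> complex) \<Rightarrow> bool" where
  "in_W g \<longleftrightarrow> (\<forall>k. loc_sup g k < \<infinity>) \<and>
      (\<lambda>k. real_of_ereal (loc_sup g k)) summable_on (UNIV :: int set)"

definition ess_inf_pos :: "(real \<Rightarrow> complex) \<Rightarrow> bool" where
  "ess_inf_pos g \<longleftrightarrow> (\<exists>c>0. AE \<xi> in lborel. \<xi> \<in> torus \<longrightarrow> c \<le> cmod (g \<xi>))"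

definition V_int :: "(real \<Rightarrow> complex) \<Rightarrow> (real \<Rightarrow> complex) set" where
  "V_int g = {h. sq_int h \<and> (\<forall>\<epsilon>>0. \<exists>J c. finite J \<and>
      l2_dist h (\<lambda>x. \<Sum>j\<in>J. c j * g (x - real_of_int j)) < \<epsilon>)}"

end

theory Submission
  imports Defs
begin

text \<open>Positive definiteness makes \<open>\<Phi>\<close> nonnegative almost everywhere, so the periodization
  \<open>P = (\<Sum>\<^sub>\<infinity>j. \<Phi> (\<cdot> + 2 \<pi> j))\<close> lies between two positive constants. Hence \<open>\<phi>\<close> and \<open>L\<close> are
  related on the Fourier side by the periodic multiplier \<open>1 / (sqrt (2 \<pi>) P)\<close>, which is bounded
  together with its inverse. Trigonometric polynomials approximate either multiplier in \<open>L\<^sub>2\<close> of the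
  torus; since the local suprema of \<open>\<Phi>\<close> are summable, this gives approximation of \<open>\<Phi>\<close>
  (respectively of the transform of \<open>L\<close>) on the whole line, and Plancherel's theorem turns
  multiplication by a trigonometric polynomial into a linear combination of integer translates.
  Thus each of \<open>\<phi>\<close>, \<open>L\<close> lies in the closed span of the translates of the other.\<close>

subsection \<open>The Fourier transform of integrable functions\<close>

text \<open>The sign of \<open>\<Phi>\<close> matters because (A2) bounds only its modulus from
  below on the torus: terms without a common sign could cancel in the periodization. For nonnegative
  \<open>\<Phi>\<close>, the term j = 0 alone gives the lower bound, and the sum of the local
  suprema gives the upper one. The multiplier is only known to be bounded and measurable, so it need
  not be a uniform limit of trigonometric polynomials. The L2 error on the torus is carried to the
  line instead: on the j-th translate of the torus the error is at most a constant times the j-th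
  local supremum times the error at the corresponding torus point, and summable suprema are square
  summable. Plancherel's theorem enters as two inequalities: the transform does not increase the L2
  norm of an integrable function, and does not decrease it if the function also has compact support.
  Both come from a Parseval identity damped by a Gaussian, in which every integral converges
  absolutely; the damping is then removed.\<close>

lemma borel_measurable_cnj [measurable]: "cnj \<in> borel_measurable borel"
  by (intro borel_measurable_continuous_onI continuous_intros)

lemma borel_measurable_fourier_int [measurable]:
  assumes [measurable]: "f \<in> borel_measurable borel"
  shows "fourier_int f \<in> borel_measurable borel"
  unfolding fourier_int_def by measurable

lemma cmod_exp_iR [simp]:
  "cmod (exp (- \<i> * complex_of_real a)) = 1" "cmod (exp (- (\<i> * complex_of_real a))) = 1"
  using norm_exp_i_times[of "-a"] by auto

lemma integrable_mult_char:
  fixes f :: "real \<Rightarrow> complex"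
  assumes "integrable lborel f"
  shows "integrable lborel (\<lambda>x. f x * exp (- \<i> * complex_of_real (\<xi> * x)))"
proof (rule Bochner_Integration.integrable_bound[OF assms])
  show "(\<lambda>x. f x * exp (- \<i> * complex_of_real (\<xi> * x))) \<in> borel_measurable lborel"
    using borel_measurable_integrable[OF assms] by measurable
qed (simp add: norm_mult)

lemma cmod_fourier_int_le:
  "cmod (fourier_int f \<xi>) \<le> (\<integral>x. cmod (f x) \<partial>lborel) / sqrt (2 * pi)"
proof -
  have "cmod (integral\<^sup>L lborel (\<lambda>x. f x * exp (- \<i> * complex_of_real (\<xi> * x))))
      \<le> (\<integral>x. cmod (f x * exp (- \<i> * complex_of_real (\<xi> * x))) \<partial>lborel)"
    by (rule integral_norm_bound)
  also have "\<dots> = (\<integral>x. cmod (f x) \<partial>lborel)" by (simp add: norm_mult)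
  finally show ?thesis
    by (simp add: fourier_int_def norm_mult norm_divide divide_right_mono)
qed

text \<open>Fubini applies because the kernel has modulus |f x| |g \<xi>|, which is integrable on
  the plane. The formula moves the transform from one factor to the other with no square
  integrability involved.\<close>

lemma integral_fourier_int_mult:
  assumes f: "integrable lborel f" and g: "integrable lborel g"
  shows "(\<integral>\<xi>. fourier_int f \<xi> * g \<xi> \<partial>lborel) = (\<integral>x. f x * fourier_int g x \<partial>lborel)"
proof -
  have [measurable]: "f \<in> borel_measurable borel" "g \<in> borel_measurable borel"
    using borel_measurable_integrable[OF f] borel_measurable_integrable[OF g] by auto
  let ?h = "\<lambda>x \<xi>. f x * g \<xi> * exp (- \<i> * complex_of_real (\<xi> * x))"
  have "integrable (lborel \<Otimes>\<^sub>M lborel) (case_prod ?h)"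
  proof (rule lborel_pair.Fubini_integrable)
    show "AE x in lborel. integrable lborel (\<lambda>y. case_prod ?h (x, y))"
    proof (rule AE_I2)
      fix x :: real
      have "integrable lborel (\<lambda>y. f x * (g y * exp (- \<i> * complex_of_real (x * y))))"
        by (intro integrable_mult_right integrable_mult_char g)
      then show "integrable lborel (\<lambda>y. case_prod ?h (x, y))"
        by (simp add: mult_ac)
    qed
    have "integrable lborel (\<lambda>x. norm (f x) * (\<integral>y. norm (g y) \<partial>lborel))"
      by (intro integrable_mult_left integrable_norm f)
    then show "integrable lborel (\<lambda>x. \<integral>y. norm (case_prod ?h (x, y)) \<partial>lborel)"
      by (simp add: norm_mult)
  qed measurable
  then have "(\<integral>\<xi>. (\<integral>x. ?h x \<xi> \<partial>lborel) \<partial>lborel) = (\<integral>x. (\<integral>\<xi>. ?h x \<xi> \<partial>lborel) \<partial>lborel)"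
    by (rule lborel_pair.Fubini_integral)
  moreover have "(\<integral>x. ?h x \<xi> \<partial>lborel) = g \<xi> * (\<integral>x. f x * exp (- \<i> * complex_of_real (\<xi> * x)) \<partial>lborel)" for \<xi>
    by (subst integral_mult_right_zero[symmetric], rule arg_cong[where f="integral\<^sup>L lborel"])
       (simp add: mult_ac)
  moreover have "(\<integral>\<xi>. ?h x \<xi> \<partial>lborel) = f x * (\<integral>\<xi>. g \<xi> * exp (- \<i> * complex_of_real (x * \<xi>)) \<partial>lborel)" for x
    by (subst integral_mult_right_zero[symmetric], rule arg_cong[where f="integral\<^sup>L lborel"])
       (simp add: mult_ac)
  ultimately have "(\<integral>\<xi>. g \<xi> * (\<integral>x. f x * exp (- \<i> * complex_of_real (\<xi> * x)) \<partial>lborel) \<partial>lborel)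
     = (\<integral>x. f x * (\<integral>\<xi>. g \<xi> * exp (- \<i> * complex_of_real (x * \<xi>)) \<partial>lborel) \<partial>lborel)"
    by simp
  moreover have "(\<integral>\<xi>. fourier_int f \<xi> * g \<xi> \<partial>lborel) = complex_of_real (1 / sqrt (2 * pi)) *
      (\<integral>\<xi>. g \<xi> * (\<integral>x. f x * exp (- \<i> * complex_of_real (\<xi> * x)) \<partial>lborel) \<partial>lborel)"
    unfolding fourier_int_def
    by (subst integral_mult_right_zero[symmetric], rule arg_cong[where f="integral\<^sup>L lborel"])
       (simp only: mult_ac)
  moreover have "(\<integral>x. f x * fourier_int g x \<partial>lborel) = complex_of_real (1 / sqrt (2 * pi)) *
      (\<integral>x. f x * (\<integral>\<xi>. g \<xi> * exp (- \<i> * complex_of_real (x * \<xi>)) \<partial>lborel) \<partial>lborel)"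
    unfolding fourier_int_def
    by (subst integral_mult_right_zero[symmetric], rule arg_cong[where f="integral\<^sup>L lborel"])
       (simp only: mult_ac)
  ultimately show ?thesis by simp
qed

section \<open>Gaussian damping and the damped Parseval identity\<close>

text \<open>This is the characteristic function of the standard normal law, rescaled by u = s \<xi>.
  Writing the result as a normal density of deviation \<open>s\<close> exhibits it as an approximate
  identity for small \<open>s\<close>.\<close>

lemma fourier_int_gauss:
  fixes s t :: real
  assumes s: "0 < s"
  shows "fourier_int (\<lambda>\<xi>. complex_of_real (exp (- (s * \<xi>)\<^sup>2 / 2))) t
     = complex_of_real (sqrt (2 * pi) * normal_density 0 s t)"
proof -
  \<comment> \<open>\<open>char\<close> integrates against exp (i t x), while
    \<open>fourier_int\<close> has the opposite sign in the exponent; hence the argument - t /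
    s.\<close>
  have "complex_of_real (exp (- (t / s)\<^sup>2 / 2)) = char std_normal_distribution (- t / s)"
    by (subst char_std_normal_distribution) simp
  also have "\<dots> = (\<integral>u. std_normal_density u *\<^sub>R exp (\<i> * complex_of_real (- t / s * u)) \<partial>lborel)"
    unfolding char_def by (subst integral_density) (auto simp: mult_ac)
  also have "\<dots> = s * (\<integral>\<xi>. std_normal_density (s * \<xi>) *\<^sub>R exp (\<i> * complex_of_real (- t / s * (s * \<xi>))) \<partial>lborel)"
    using s by (subst lborel_integral_real_affine[where c=s and t=0]) (auto simp: scaleR_conv_of_real)
  also have "(\<lambda>\<xi>. std_normal_density (s * \<xi>) *\<^sub>R exp (\<i> * complex_of_real (- t / s * (s * \<xi>))))
     = (\<lambda>\<xi>. complex_of_real (1 / sqrt (2 * pi)) * (complex_of_real (exp (- (s * \<xi>)\<^sup>2 / 2)) * exp (- \<i> * complex_of_real (t * \<xi>))))"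
    using s by (auto simp: fun_eq_iff std_normal_density_def scaleR_conv_of_real field_simps)
  also have "s * (\<integral>\<xi>. complex_of_real (1 / sqrt (2 * pi)) * (complex_of_real (exp (- (s * \<xi>)\<^sup>2 / 2)) * exp (- \<i> * complex_of_real (t * \<xi>))) \<partial>lborel)
    = s * fourier_int (\<lambda>\<xi>. complex_of_real (exp (- (s * \<xi>)\<^sup>2 / 2))) t"
    by (simp only: fourier_int_def integral_mult_right_zero)
  finally have "fourier_int (\<lambda>\<xi>. complex_of_real (exp (- (s * \<xi>)\<^sup>2 / 2))) t = complex_of_real (exp (- (t / s)\<^sup>2 / 2)) / s"
    using s by (simp add: field_simps)
  also have "\<dots> = complex_of_real (exp (- (t / s)\<^sup>2 / 2) / s)" by simp
  also have "exp (- (t / s)\<^sup>2 / 2) / s = sqrt (2 * pi) * normal_density 0 s t"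
    using s by (simp add: normal_density_def real_sqrt_mult power_divide field_simps)
  finally show ?thesis .
qed

lemma integrable_gauss:
  fixes s :: real
  assumes s: "0 < s"
  shows "integrable lborel (\<lambda>\<xi>. exp (- (s * \<xi>)\<^sup>2 / 2))"
proof -
  have "(\<lambda>\<xi>. exp (- (s * \<xi>)\<^sup>2 / 2)) = (\<lambda>\<xi>. sqrt (2 * pi) / s * normal_density 0 (1 / s) \<xi>)"
    using s by (auto simp: normal_density_def real_sqrt_mult real_sqrt_divide power_mult_distrib field_simps)
  then show ?thesis using s by simp
qed

text \<open>A Parseval identity damped by a Gaussian. The weight makes the left side absolutely
  convergent although \<open>f\<close> and \<open>g\<close> are only integrable; on the right it
  turns into convolution of the conjugate of \<open>g\<close> with a normal density.\<close>

lemma gauss_pairing: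
  assumes f: "integrable lborel f" and g: "integrable lborel g" and s: "0 < s"
  shows "(\<integral>\<xi>. fourier_int f \<xi> * (cnj (fourier_int g \<xi>) * complex_of_real (exp (- (s * \<xi>)\<^sup>2 / 2))) \<partial>lborel)
    = (\<integral>x. f x * (\<integral>y. cnj (g y) * complex_of_real (normal_density 0 s (x - y)) \<partial>lborel) \<partial>lborel)"
proof -
  have [measurable]: "f \<in> borel_measurable borel" "g \<in> borel_measurable borel"
    using borel_measurable_integrable[OF f] borel_measurable_integrable[OF g] by auto
  let ?w = "\<lambda>\<xi>. complex_of_real (exp (- (s * \<xi>)\<^sup>2 / 2))"
  let ?g = "\<lambda>y. cnj (g (- y))"
  have wi: "integrable lborel ?w"
    using integrable_gauss[OF s] by (rule integrable_of_real)
  have gi: "integrable lborel ?g"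
    using lborel_integrable_real_affine[OF g, of "-1" 0] by simp
  \<comment> \<open>Conjugating and reflecting \<open>g\<close> conjugates its transform, so the
    conjugated factor is again a transform and the multiplication formula applies to it.\<close>
  have cg: "cnj (fourier_int g \<xi>) = fourier_int ?g \<xi>" for \<xi>
  proof -
    have "cnj (fourier_int g \<xi>) = complex_of_real (1 / sqrt (2 * pi)) *
       (\<integral>x. cnj (g x * exp (- \<i> * complex_of_real (\<xi> * x))) \<partial>lborel)"
      using Bochner_Integration.integral_cnj[of lborel "\<lambda>x. g x * exp (- \<i> * complex_of_real (\<xi> * x))"]
      by (simp only: fourier_int_def complex_cnj_mult complex_cnj_complex_of_real)
    also have "\<dots> = fourier_int ?g \<xi>"
      unfolding fourier_int_def
      by (subst lborel_integral_real_affine[where c="-1" and t=0]) (auto simp: exp_cnj)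
    finally show ?thesis .
  qed
  have Gi: "integrable lborel (\<lambda>\<xi>. cnj (fourier_int g \<xi>) * ?w \<xi>)"
  proof (rule Bochner_Integration.integrable_bound)
    let ?K = "(\<integral>x. cmod (g x) \<partial>lborel) / sqrt (2 * pi)"
    show "integrable lborel (\<lambda>\<xi>. ?K * exp (- (s * \<xi>)\<^sup>2 / 2))"
      using integrable_gauss[OF s] by (rule integrable_mult_right)
    show "AE x in lborel. norm (cnj (fourier_int g x) * ?w x) \<le> norm (?K * exp (- (s * x)\<^sup>2 / 2))"
      using mult_right_mono[OF cmod_fourier_int_le[of g]] by (auto simp: norm_mult abs_mult)
  qed measurable
  have shift: "fourier_int (\<lambda>\<xi>. cnj (fourier_int g \<xi>) * ?w \<xi>) x
      = (\<integral>y. cnj (g y) * complex_of_real (normal_density 0 s (x - y)) \<partial>lborel)" for x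
  proof -
    \<comment> \<open>The outer character is absorbed into the weight, so the second use of the
      multiplication formula needs only the transform of a Gaussian, evaluated at the translated
      point x + y.\<close>
    let ?W = "\<lambda>\<xi>. ?w \<xi> * exp (- \<i> * complex_of_real (x * \<xi>))"
    have "fourier_int (\<lambda>\<xi>. cnj (fourier_int g \<xi>) * ?w \<xi>) x
       = complex_of_real (1 / sqrt (2 * pi)) * (\<integral>\<xi>. fourier_int ?g \<xi> * ?W \<xi> \<partial>lborel)"
      unfolding cg by (subst fourier_int_def) (simp add: mult_ac)
    also have "(\<integral>\<xi>. fourier_int ?g \<xi> * ?W \<xi> \<partial>lborel) = (\<integral>y. ?g y * fourier_int ?W y \<partial>lborel)"
      by (rule integral_fourier_int_mult[OF gi integrable_mult_char[OF wi]])
    also have "(\<lambda>y. fourier_int ?W y) = (\<lambda>y. complex_of_real (sqrt (2 * pi)) * complex_of_real (normal_density 0 s (x + y)))"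
    proof
      fix y
      have "fourier_int ?W y = fourier_int ?w (x + y)"
        unfolding fourier_int_def
        by (simp add: mult.assoc exp_add exp_diff exp_minus field_simps)
      then show "fourier_int ?W y = complex_of_real (sqrt (2 * pi)) * complex_of_real (normal_density 0 s (x + y))"
        using fourier_int_gauss[OF s] by simp
    qed
    also have "complex_of_real (1 / sqrt (2 * pi)) * (\<integral>y. ?g y * (complex_of_real (sqrt (2 * pi)) * complex_of_real (normal_density 0 s (x + y))) \<partial>lborel)
      = (\<integral>y. ?g y * complex_of_real (normal_density 0 s (x + y)) \<partial>lborel)"
      by (subst integral_mult_right_zero[symmetric], rule arg_cong[where f="integral\<^sup>L lborel"]) auto
    also have "\<dots> = (\<integral>y. cnj (g y) * complex_of_real (normal_density 0 s (x - y)) \<partial>lborel)"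
      by (subst lborel_integral_real_affine[where c="-1" and t=0]) auto
    finally show ?thesis .
  qed
  show ?thesis
    unfolding integral_fourier_int_mult[OF f Gi] shift ..
qed

subsection \<open>The Plancherel inequalities\<close>

text \<open>The squared L2 norm, with values in \<open>ennreal\<close> so that estimates and limits
  need no finiteness side conditions.\<close>

definition L2_energy :: "(real \<Rightarrow> complex) \<Rightarrow> ennreal" where
  "L2_energy f = (\<integral>\<^sup>+x. ennreal ((cmod (f x))\<^sup>2) \<partial>lborel)"

text \<open>The Bochner integral of a nonintegrable function is 0 by convention, so the bound holds
  in that case as well.\<close>

lemma norm_integral_le_nn_integral:
  fixes f :: "'a \<Rightarrow> complex"
  shows "ennreal (cmod (integral\<^sup>L M f)) \<le> (\<integral>\<^sup>+x. ennreal (cmod (f x)) \<partial>M)"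
proof (cases "integrable M f")
  case True then show ?thesis by (rule integral_norm_bound_ennreal)
qed (simp add: not_integrable_integral_eq)

text \<open>Fatou's lemma, in the form that passes a uniform bound to an almost everywhere
  limit.\<close>

lemma nn_integral_le_limit:
  fixes u :: "nat \<Rightarrow> 'a \<Rightarrow> ennreal"
  assumes [measurable]: "\<And>n. u n \<in> borel_measurable M"
    and lim: "AE x in M. (\<lambda>n. u n x) \<longlonglongrightarrow> v x"
    and le: "\<And>n. (\<integral>\<^sup>+x. u n x \<partial>M) \<le> C"
  shows "(\<integral>\<^sup>+x. v x \<partial>M) \<le> C"
proof -
  have "(\<integral>\<^sup>+x. v x \<partial>M) = (\<integral>\<^sup>+x. liminf (\<lambda>n. u n x) \<partial>M)"
    using lim by (intro nn_integral_cong_AE) (auto dest!: lim_imp_Liminf[rotated])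
  also have "\<dots> \<le> liminf (\<lambda>n. \<integral>\<^sup>+x. u n x \<partial>M)"
    by (rule nn_integral_liminf) auto
  also have "\<dots> \<le> liminf (\<lambda>n::nat. C)"
    by (rule Liminf_mono) (auto simp: le)
  also have "\<dots> = C" by (simp add: Liminf_const)
  finally show ?thesis .
qed

text \<open>The triangle inequality in squared form, from 2ab \<le> a^2 + b^2. The factors 2 are
  harmless wherever the energies tend to 0, and they reappear as the constants 4 further on.\<close>

lemma L2_energy_add_le:
  assumes [measurable]: "f \<in> borel_measurable borel" "g \<in> borel_measurable borel"
  shows "L2_energy (\<lambda>x. f x + g x) \<le> 2 * L2_energy f + 2 * L2_energy g"
proof -
  have "(cmod (a + b))\<^sup>2 \<le> 2 * (cmod a)\<^sup>2 + 2 * (cmod b)\<^sup>2" for a b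
  proof -
    have "(cmod (a + b))\<^sup>2 \<le> (cmod a + cmod b)\<^sup>2"
      by (intro power_mono norm_triangle_ineq) auto
    also have "\<dots> \<le> 2 * (cmod a)\<^sup>2 + 2 * (cmod b)\<^sup>2"
      using sum_squares_bound[of "cmod a" "cmod b"] by (simp add: power2_sum)
    finally show ?thesis .
  qed
  then have "L2_energy (\<lambda>x. f x + g x) \<le> (\<integral>\<^sup>+x. ennreal (2 * (cmod (f x))\<^sup>2 + 2 * (cmod (g x))\<^sup>2) \<partial>lborel)"
    unfolding L2_energy_def by (intro nn_integral_mono ennreal_leI)
  also have "\<dots> = (\<integral>\<^sup>+x. 2 * ennreal ((cmod (f x))\<^sup>2) + 2 * ennreal ((cmod (g x))\<^sup>2) \<partial>lborel)"
    by (simp add: ennreal_mult)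
  also have "\<dots> = 2 * L2_energy f + 2 * L2_energy g"
    unfolding L2_energy_def by (simp add: nn_integral_add nn_integral_cmult)
  finally show ?thesis .
qed

lemma L2_energy_cmult:
  assumes [measurable]: "f \<in> borel_measurable borel"
  shows "L2_energy (\<lambda>x. c * f x) = ennreal ((cmod c)\<^sup>2) * L2_energy f"
  unfolding L2_energy_def
  by (simp add: norm_mult power_mult_distrib ennreal_mult nn_integral_cmult)

lemma L2_energy_shift:
  assumes [measurable]: "f \<in> borel_measurable borel"
  shows "L2_energy (\<lambda>x. f (x - t)) = L2_energy f"
  unfolding L2_energy_def
  by (subst (2) nn_integral_real_affine[where c=1 and t="-t"]) auto

lemma L2_energy_cong: "(\<And>x. cmod (f x) = cmod (g x)) \<Longrightarrow> L2_energy f = L2_energy g"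
  unfolding L2_energy_def by simp

lemma nn_integral_normal_density_diff:
  assumes s: "0 < s"
  shows "(\<integral>\<^sup>+y. ennreal (normal_density 0 s (x - y)) \<partial>lborel) = 1"
proof -
  have "(\<integral>\<^sup>+y. ennreal (normal_density 0 s (x - y)) \<partial>lborel) = (\<integral>\<^sup>+y. ennreal (normal_density 0 s y) \<partial>lborel)"
    by (subst (2) nn_integral_real_affine[where c="-1" and t=x]) auto
  then show ?thesis using s by (simp add: nn_integral_eq_integral)
qed

text \<open>For g = f the damped Parseval identity makes the left side a quadratic form in
  \<open>f\<close> with kernel \<open>normal_density 0 s (x - y)\<close>. Schur's test bounds it: |f
  x| |f y| is at most half of |f x|^2 + |f y|^2, and the kernel has mass 1 in each variable.\<close>

lemma nn_integral_gauss_fourier_int_le: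
  assumes f: "integrable lborel f" and s: "0 < s"
  shows "(\<integral>\<^sup>+\<xi>. ennreal ((cmod (fourier_int f \<xi>))\<^sup>2 * exp (- (s * \<xi>)\<^sup>2 / 2)) \<partial>lborel) \<le> L2_energy f"
proof -
  have [measurable]: "f \<in> borel_measurable borel"
    using borel_measurable_integrable[OF f] by auto
  let ?w = "\<lambda>\<xi>. exp (- (s * \<xi>)\<^sup>2 / 2)"
  let ?K = "(\<integral>x. cmod (f x) \<partial>lborel) / sqrt (2 * pi)"
  let ?n = "\<lambda>x y. normal_density 0 s (x - y)"
  have i: "integrable lborel (\<lambda>\<xi>. (cmod (fourier_int f \<xi>))\<^sup>2 * ?w \<xi>)"
  proof (rule Bochner_Integration.integrable_bound)
    show "integrable lborel (\<lambda>\<xi>. ?K\<^sup>2 * ?w \<xi>)"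
      using integrable_gauss[OF s] by (rule integrable_mult_right)
    have "(cmod (fourier_int f \<xi>))\<^sup>2 * ?w \<xi> \<le> ?K\<^sup>2 * ?w \<xi>" for \<xi>
      by (intro mult_right_mono power_mono cmod_fourier_int_le) auto
    then show "AE x in lborel. norm ((cmod (fourier_int f x))\<^sup>2 * ?w x) \<le> norm (?K\<^sup>2 * ?w x)"
      by (auto simp: abs_mult)
  qed measurable
  have "complex_of_real (\<integral>\<xi>. (cmod (fourier_int f \<xi>))\<^sup>2 * ?w \<xi> \<partial>lborel)
      = (\<integral>\<xi>. fourier_int f \<xi> * (cnj (fourier_int f \<xi>) * complex_of_real (?w \<xi>)) \<partial>lborel)"
    unfolding mult.assoc[symmetric] complex_norm_square[symmetric] of_real_mult[symmetric]
      Bochner_Integration.integral_complex_of_real ..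
  also have "\<dots> = (\<integral>x. f x * (\<integral>y. cnj (f y) * complex_of_real (?n x y) \<partial>lborel) \<partial>lborel)"
    by (rule gauss_pairing[OF f f s])
  finally have e: "complex_of_real (\<integral>\<xi>. (cmod (fourier_int f \<xi>))\<^sup>2 * ?w \<xi> \<partial>lborel) = \<dots>" .
  have "(\<integral>\<^sup>+\<xi>. ennreal ((cmod (fourier_int f \<xi>))\<^sup>2 * ?w \<xi>) \<partial>lborel)
      = ennreal (\<integral>\<xi>. (cmod (fourier_int f \<xi>))\<^sup>2 * ?w \<xi> \<partial>lborel)"
    by (rule nn_integral_eq_integral[OF i]) auto
  also have "(\<integral>\<xi>. (cmod (fourier_int f \<xi>))\<^sup>2 * ?w \<xi> \<partial>lborel) = cmod (complex_of_real (\<integral>\<xi>. (cmod (fourier_int f \<xi>))\<^sup>2 * ?w \<xi> \<partial>lborel))"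
    unfolding norm_of_real by (rule abs_of_nonneg[symmetric]) (auto intro!: integral_nonneg_AE)
  also have "ennreal \<dots> \<le> (\<integral>\<^sup>+x. ennreal (cmod (f x * (\<integral>y. cnj (f y) * complex_of_real (?n x y) \<partial>lborel))) \<partial>lborel)"
    unfolding e by (rule norm_integral_le_nn_integral)
  also have "\<dots> \<le> (\<integral>\<^sup>+x. \<integral>\<^sup>+y. ennreal (cmod (f x) * (cmod (f y) * ?n x y)) \<partial>lborel \<partial>lborel)"
  proof (intro nn_integral_mono)
    fix x
    have "ennreal (cmod (f x * (\<integral>y. cnj (f y) * complex_of_real (?n x y) \<partial>lborel)))
      = ennreal (cmod (f x)) * ennreal (cmod (\<integral>y. cnj (f y) * complex_of_real (?n x y) \<partial>lborel))"
      by (simp add: norm_mult ennreal_mult)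
    also have "\<dots> \<le> ennreal (cmod (f x)) * (\<integral>\<^sup>+y. ennreal (cmod (cnj (f y) * complex_of_real (?n x y))) \<partial>lborel)"
      by (intro mult_left_mono norm_integral_le_nn_integral) auto
    also have "\<dots> = (\<integral>\<^sup>+y. ennreal (cmod (f x) * (cmod (f y) * ?n x y)) \<partial>lborel)"
      by (subst nn_integral_cmult[symmetric]) (auto simp: norm_mult ennreal_mult)
    finally show "ennreal (cmod (f x * (\<integral>y. cnj (f y) * complex_of_real (?n x y) \<partial>lborel))) \<le> \<dots>" .
  qed
  also have "\<dots> \<le> (\<integral>\<^sup>+x. \<integral>\<^sup>+y. ennreal ((cmod (f x))\<^sup>2 / 2) * ennreal (?n x y) + ennreal ((cmod (f y))\<^sup>2 / 2) * ennreal (?n x y) \<partial>lborel \<partial>lborel)"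
  proof (intro nn_integral_mono)
    fix x y
    have "cmod (f x) * (cmod (f y) * ?n x y) \<le> ((cmod (f x))\<^sup>2 / 2 + (cmod (f y))\<^sup>2 / 2) * ?n x y"
      unfolding mult.assoc[symmetric]
      using sum_squares_bound[of "cmod (f x)" "cmod (f y)"] by (intro mult_right_mono) auto
    then have "ennreal (cmod (f x) * (cmod (f y) * ?n x y)) \<le> ennreal (((cmod (f x))\<^sup>2 / 2 + (cmod (f y))\<^sup>2 / 2) * ?n x y)"
      by (rule ennreal_leI)
    then show "ennreal (cmod (f x) * (cmod (f y) * ?n x y)) \<le> ennreal ((cmod (f x))\<^sup>2 / 2) * ennreal (?n x y) + ennreal ((cmod (f y))\<^sup>2 / 2) * ennreal (?n x y)"
      by (subst (1 2) ennreal_mult[symmetric]) (simp_all add: distrib_right)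
  qed
  also have "\<dots> = (\<integral>\<^sup>+x. \<integral>\<^sup>+y. ennreal ((cmod (f x))\<^sup>2 / 2) * ennreal (?n x y) \<partial>lborel \<partial>lborel)
      + (\<integral>\<^sup>+x. \<integral>\<^sup>+y. ennreal ((cmod (f y))\<^sup>2 / 2) * ennreal (?n x y) \<partial>lborel \<partial>lborel)"
    by (subst nn_integral_add[symmetric]) (auto simp: nn_integral_add)
  also have "(\<integral>\<^sup>+x. \<integral>\<^sup>+y. ennreal ((cmod (f x))\<^sup>2 / 2) * ennreal (?n x y) \<partial>lborel \<partial>lborel) = (\<integral>\<^sup>+x. ennreal ((cmod (f x))\<^sup>2 / 2) \<partial>lborel)"
    using s by (simp add: nn_integral_cmult nn_integral_normal_density_diff)
  also have "(\<integral>\<^sup>+x. \<integral>\<^sup>+y. ennreal ((cmod (f y))\<^sup>2 / 2) * ennreal (?n x y) \<partial>lborel \<partial>lborel)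
     = (\<integral>\<^sup>+y. \<integral>\<^sup>+x. ennreal ((cmod (f y))\<^sup>2 / 2) * ennreal (?n x y) \<partial>lborel \<partial>lborel)"
    by (rule lborel_pair.Fubini'[symmetric]) measurable
  also have "\<dots> = (\<integral>\<^sup>+y. \<integral>\<^sup>+x. ennreal ((cmod (f y))\<^sup>2 / 2) * ennreal (?n y x) \<partial>lborel \<partial>lborel)"
    by (simp add: normal_density_def power2_commute)
  also have "\<dots> = (\<integral>\<^sup>+x. ennreal ((cmod (f x))\<^sup>2 / 2) \<partial>lborel)"
    using s by (simp add: nn_integral_cmult nn_integral_normal_density_diff)
  also have "(\<integral>\<^sup>+x. ennreal ((cmod (f x))\<^sup>2 / 2) \<partial>lborel) + (\<integral>\<^sup>+x. ennreal ((cmod (f x))\<^sup>2 / 2) \<partial>lborel) = L2_energy f"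
    unfolding L2_energy_def by (subst nn_integral_add[symmetric]) (auto simp: ennreal_plus[symmetric] simp del: ennreal_plus)
  finally show ?thesis .
qed

lemma tendsto_gauss_weight:
  "(\<lambda>n. exp (- (1 / real (Suc n) * \<xi>)\<^sup>2 / 2)) \<longlonglongrightarrow> 1"
proof -
  have "(\<lambda>n. exp (- (1 / real (Suc n) * \<xi>)\<^sup>2 / 2)) \<longlonglongrightarrow> exp (- (0 * \<xi>)\<^sup>2 / 2)"
    by (intro tendsto_intros LIMSEQ_Suc[OF lim_1_over_n]) auto
  then show ?thesis by simp
qed

text \<open>The Gaussian weights tend to 1 pointwise, and the damped bound is uniform in them, so
  Fatou's lemma removes the damping.\<close>

lemma L2_energy_fourier_int_le:
  assumes f: "integrable lborel f"
  shows "L2_energy (fourier_int f) \<le> L2_energy f"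
  unfolding L2_energy_def
proof (rule nn_integral_le_limit)
  have [measurable]: "f \<in> borel_measurable borel"
    using borel_measurable_integrable[OF f] by auto
  let ?u = "\<lambda>n \<xi>. ennreal ((cmod (fourier_int f \<xi>))\<^sup>2 * exp (- (1 / real (Suc n) * \<xi>)\<^sup>2 / 2))"
  show "?u n \<in> borel_measurable lborel" for n by measurable
  have "(\<lambda>n. ?u n \<xi>) \<longlonglongrightarrow> ennreal ((cmod (fourier_int f \<xi>))\<^sup>2 * 1)" for \<xi>
    by (intro tendsto_ennrealI tendsto_mult tendsto_const tendsto_gauss_weight)
  then show "AE \<xi> in lborel. (\<lambda>n. ?u n \<xi>) \<longlonglongrightarrow> ennreal ((cmod (fourier_int f \<xi>))\<^sup>2)"
    by simp
  show "(\<integral>\<^sup>+\<xi>. ?u n \<xi> \<partial>lborel) \<le> (\<integral>\<^sup>+ x. ennreal ((cmod (f x))\<^sup>2) \<partial>lborel)" for n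
    using nn_integral_gauss_fourier_int_le[OF f, of "1 / real (Suc n)"] unfolding L2_energy_def by simp
qed

section \<open>The reverse Plancherel inequality, by duality with continuous test functions\<close>

text \<open>A Lebesgue measurable function is a limit of continuous functions off a negligible set.
  Clipping these to [-B, B] keeps the limit since |q| \<le> B, and a cutoff makes them vanish
  outside (-R, R). The common bound and support are what dominated convergence uses later.\<close>

lemma bounded_measurable_limit_continuous:
  fixes q :: "real \<Rightarrow> real"
  assumes q: "q \<in> borel_measurable borel" and B: "\<And>x. \<bar>q x\<bar> \<le> B"
  obtains g :: "nat \<Rightarrow> real \<Rightarrow> real"
  where "\<And>n. continuous_on UNIV (g n)" "\<And>n x. \<bar>g n x\<bar> \<le> B"
    "\<And>n x. R \<le> \<bar>x\<bar> \<Longrightarrow> g n x = 0"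
    "AE x in lborel. \<bar>x\<bar> < R \<longrightarrow> (\<lambda>n. g n x) \<longlonglongrightarrow> q x"
proof -
  have B0: "0 \<le> B" using B[of 0] by linarith
  have "q \<in> borel_measurable lebesgue"
    using q by (simp add: measurable_completion)
  then have "q measurable_on UNIV"
    by (intro lebesgue_measurable_imp_measurable_on_real) auto
  then obtain N h where N: "negligible N" and h: "\<And>n. continuous_on UNIV (h n)"
    and lim: "\<And>x. x \<notin> N \<Longrightarrow> (\<lambda>n::nat. h n x) \<longlonglongrightarrow> q x"
    unfolding measurable_on_def by auto
  \<comment> \<open>A trapezoid vanishing for |x| \<ge> R whose slope \<open>n\<close> grows, so at
    each point of (-R, R) it eventually equals 1.\<close>
  define k where "k = (\<lambda>(n::nat) x. max 0 (min 1 (real n * (R - \<bar>x\<bar>))))"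
  define g where "g = (\<lambda>n x. max (-B) (min B (h n x)) * k n x)"
  have k01: "0 \<le> k n x" "k n x \<le> 1" for n x by (auto simp: k_def)
  show thesis
  proof (rule that)
    show "continuous_on UNIV (g n)" for n
      unfolding g_def k_def by (intro continuous_intros h)
    show "\<bar>g n x\<bar> \<le> B" for n x
    proof -
      have "\<bar>max (-B) (min B (h n x))\<bar> \<le> B" using B0 by auto
      then have "\<bar>max (-B) (min B (h n x))\<bar> * \<bar>k n x\<bar> \<le> B * 1"
        using k01[of n x] B0 by (intro mult_mono) auto
      then show ?thesis by (simp add: g_def abs_mult)
    qed
    show "g n x = 0" if "R \<le> \<bar>x\<bar>" for n x
    proof -
      have "real n * (R - \<bar>x\<bar>) \<le> 0" using that by (intro mult_nonneg_nonpos) auto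
      then show ?thesis by (simp add: g_def k_def)
    qed
    have "AE x in lebesgue. x \<notin> N"
      using N by (simp add: negligible_iff_null_sets AE_not_in)
    then have "AE x in lborel. x \<notin> N"
      by (simp add: AE_completion_iff)
    then show "AE x in lborel. \<bar>x\<bar> < R \<longrightarrow> (\<lambda>n. g n x) \<longlonglongrightarrow> q x"
    proof eventually_elim
      case (elim x)
      show ?case
      proof
        assume x: "\<bar>x\<bar> < R"
        obtain n0 :: nat where n0: "1 / (R - \<bar>x\<bar>) < real n0" using reals_Archimedean2 by blast
        have "eventually (\<lambda>n. k n x = 1) sequentially"
        proof (rule eventually_sequentiallyI)
          fix n assume "n0 \<le> n"
          then have "1 / (R - \<bar>x\<bar>) \<le> real n" using n0 by linarith
          then have "1 \<le> real n * (R - \<bar>x\<bar>)" using x by (simp add: divide_simps)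
          then show "k n x = 1" by (simp add: k_def)
        qed
        then have "(\<lambda>n. k n x) \<longlonglongrightarrow> 1" by (rule tendsto_eventually)
        moreover have "(\<lambda>n. max (-B) (min B (h n x))) \<longlonglongrightarrow> max (-B) (min B (q x))"
          by (intro tendsto_intros lim elim)
        ultimately have "(\<lambda>n. g n x) \<longlonglongrightarrow> max (-B) (min B (q x)) * 1"
          unfolding g_def by (intro tendsto_mult)
        then show "(\<lambda>n. g n x) \<longlonglongrightarrow> q x"
          using B[of x] by (simp add: max_def min_def abs_le_iff split: if_splits)
      qed
    qed
  qed
qed

text \<open>The substitution y = x - s z moves the scale \<open>s\<close> out of the density and
  into the argument of \<open>g\<close>. Continuity of \<open>g\<close> then gives the pointwise
  limit, and \<open>B\<close> times the standard density dominates.\<close>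

lemma gauss_convolution_tendsto:
  fixes g :: "real \<Rightarrow> complex"
  assumes c: "continuous_on UNIV g" and B: "\<And>x. cmod (g x) \<le> B"
  shows "(\<lambda>n. \<integral>y. cnj (g y) * complex_of_real (normal_density 0 (1 / real (Suc n)) (x - y)) \<partial>lborel)
     \<longlonglongrightarrow> cnj (g x)"
proof -
  have [measurable]: "g \<in> borel_measurable borel"
    using c by (rule borel_measurable_continuous_onI)
  have eq: "(\<integral>y. cnj (g y) * complex_of_real (normal_density 0 s (x - y)) \<partial>lborel)
     = (\<integral>z. cnj (g (x - s * z)) * complex_of_real (std_normal_density z) \<partial>lborel)" if s: "0 < s" for s
  proof -
    have "(\<integral>y. cnj (g y) * complex_of_real (normal_density 0 s (x - y)) \<partial>lborel)
      = s *\<^sub>R (\<integral>z. cnj (g (x - s * z)) * complex_of_real (normal_density 0 s (s * z)) \<partial>lborel)"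
      using s by (subst lborel_integral_real_affine[where c="-s" and t=x]) auto
    also have "\<dots> = (\<integral>z. s *\<^sub>R (cnj (g (x - s * z)) * complex_of_real (normal_density 0 s (s * z))) \<partial>lborel)"
      by (simp only: integral_scaleR_right)
    also have "(\<lambda>z. s *\<^sub>R (cnj (g (x - s * z)) * complex_of_real (normal_density 0 s (s * z))))
       = (\<lambda>z. cnj (g (x - s * z)) * complex_of_real (std_normal_density z))"
      using s by (auto simp: fun_eq_iff normal_density_def scaleR_conv_of_real real_sqrt_mult power_mult_distrib field_simps)
    finally show ?thesis .
  qed
  have "(\<lambda>n. \<integral>z. cnj (g (x - 1 / real (Suc n) * z)) * complex_of_real (std_normal_density z) \<partial>lborel)
    \<longlonglongrightarrow> (\<integral>z. cnj (g (x - 0 * z)) * complex_of_real (std_normal_density z) \<partial>lborel)"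
  proof (rule integral_dominated_convergence)
    show "integrable lborel (\<lambda>z. B * std_normal_density z)" by simp
    show "AE z in lborel. (\<lambda>n. cnj (g (x - 1 / real (Suc n) * z)) * complex_of_real (std_normal_density z))
       \<longlonglongrightarrow> cnj (g (x - 0 * z)) * complex_of_real (std_normal_density z)"
    proof (rule AE_I2)
      fix z
      have "isCont g (x - 0 * z)" using c by (simp add: continuous_on_eq_continuous_at)
      moreover have "(\<lambda>n. x - 1 / real (Suc n) * z) \<longlonglongrightarrow> x - 0 * z"
        by (intro tendsto_intros LIMSEQ_Suc[OF lim_1_over_n])
      ultimately have "(\<lambda>n. g (x - 1 / real (Suc n) * z)) \<longlonglongrightarrow> g (x - 0 * z)"
        by (rule isCont_tendsto_compose)
      then show "(\<lambda>n. cnj (g (x - 1 / real (Suc n) * z)) * complex_of_real (std_normal_density z))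
       \<longlonglongrightarrow> cnj (g (x - 0 * z)) * complex_of_real (std_normal_density z)"
        by (intro tendsto_mult tendsto_const tendsto_cnj)
    qed
    show "AE z in lborel. norm (cnj (g (x - 1 / real (Suc n) * z)) * complex_of_real (std_normal_density z)) \<le> B * std_normal_density z" for n
      by (auto simp: norm_mult intro!: mult_right_mono B)
  qed measurable
  moreover have "(\<integral>z. cnj (g (x - 0 * z)) * complex_of_real (std_normal_density z) \<partial>lborel) = cnj (g x)"
    by simp
  ultimately show ?thesis by (simp add: eq)
qed

lemma norm_gauss_convolution_le:
  fixes g :: "real \<Rightarrow> complex"
  assumes [measurable]: "g \<in> borel_measurable borel" and B: "\<And>x. cmod (g x) \<le> B" and s: "0 < s"
  shows "cmod (\<integral>y. cnj (g y) * complex_of_real (normal_density 0 s (x - y)) \<partial>lborel) \<le> B"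
proof -
  have B0: "0 \<le> B" using B[of 0] norm_ge_zero order_trans by blast
  have "ennreal (cmod (\<integral>y. cnj (g y) * complex_of_real (normal_density 0 s (x - y)) \<partial>lborel))
     \<le> (\<integral>\<^sup>+y. ennreal (cmod (cnj (g y) * complex_of_real (normal_density 0 s (x - y)))) \<partial>lborel)"
    by (rule norm_integral_le_nn_integral)
  also have "\<dots> \<le> (\<integral>\<^sup>+y. ennreal B * ennreal (normal_density 0 s (x - y)) \<partial>lborel)"
    by (intro nn_integral_mono) (auto simp: norm_mult ennreal_mult[symmetric] B0 intro!: ennreal_leI mult_right_mono B)
  also have "\<dots> = ennreal B"
    using s by (simp add: nn_integral_cmult nn_integral_normal_density_diff)
  finally show ?thesis using B0 by simp
qed

text \<open>Damped Parseval followed by 2ab \<le> a^2 + b^2 bounds the damped pairing by the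
  energies of both transforms, and the transform of \<open>g\<close> has at most the energy of
  \<open>g\<close>. Continuity of \<open>g\<close> lets the damping be removed on the left. The sum
  of energies replaces the Cauchy-Schwarz product and avoids square roots in
  \<open>ennreal\<close>.\<close>

lemma pairing_le_continuous:
  assumes f: "integrable lborel f" and g: "integrable lborel g"
    and c: "continuous_on UNIV g" and B: "\<And>x. cmod (g x) \<le> B"
  shows "ennreal (2 * cmod (\<integral>x. f x * cnj (g x) \<partial>lborel)) \<le> L2_energy (fourier_int f) + L2_energy g"
proof -
  have [measurable]: "f \<in> borel_measurable borel" "g \<in> borel_measurable borel"
    using borel_measurable_integrable[OF f] borel_measurable_integrable[OF g] by auto
  define I where "I = (\<lambda>n. \<integral>x. f x * (\<integral>y. cnj (g y) * complex_of_real (normal_density 0 (1 / real (Suc n)) (x - y)) \<partial>lborel) \<partial>lborel)"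
  have "I \<longlonglongrightarrow> (\<integral>x. f x * cnj (g x) \<partial>lborel)"
    unfolding I_def
  proof (rule integral_dominated_convergence)
    show "integrable lborel (\<lambda>x. cmod (f x) * B)"
      by (intro integrable_mult_left integrable_norm f)
    show "AE x in lborel. (\<lambda>n. f x * (\<integral>y. cnj (g y) * complex_of_real (normal_density 0 (1 / real (Suc n)) (x - y)) \<partial>lborel))
        \<longlonglongrightarrow> f x * cnj (g x)"
      by (intro AE_I2 tendsto_mult tendsto_const gauss_convolution_tendsto[OF c B])
    show "AE x in lborel. norm (f x * (\<integral>y. cnj (g y) * complex_of_real (normal_density 0 (1 / real (Suc n)) (x - y)) \<partial>lborel))
        \<le> cmod (f x) * B" for n
      unfolding norm_mult by (intro AE_I2 mult_left_mono norm_gauss_convolution_le) (auto simp: B)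
  qed measurable
  then have lim: "(\<lambda>n. ennreal (2 * cmod (I n))) \<longlonglongrightarrow> ennreal (2 * cmod (\<integral>x. f x * cnj (g x) \<partial>lborel))"
    by (intro tendsto_intros tendsto_ennrealI)
  have "ennreal (2 * cmod (I n)) \<le> L2_energy (fourier_int f) + L2_energy g" for n
  proof -
    let ?w = "\<lambda>\<xi>. exp (- (1 / real (Suc n) * \<xi>)\<^sup>2 / 2)"
    have "I n = (\<integral>\<xi>. fourier_int f \<xi> * (cnj (fourier_int g \<xi>) * complex_of_real (?w \<xi>)) \<partial>lborel)"
      unfolding I_def by (rule gauss_pairing[OF f g, symmetric]) simp
    then have "ennreal (cmod (I n)) \<le> (\<integral>\<^sup>+\<xi>. ennreal (cmod (fourier_int f \<xi> * (cnj (fourier_int g \<xi>) * complex_of_real (?w \<xi>)))) \<partial>lborel)"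
      using norm_integral_le_nn_integral by simp
    then have "2 * ennreal (cmod (I n)) \<le> 2 * (\<integral>\<^sup>+\<xi>. ennreal (cmod (fourier_int f \<xi> * (cnj (fourier_int g \<xi>) * complex_of_real (?w \<xi>)))) \<partial>lborel)"
      by (intro mult_left_mono) auto
    also have "\<dots> = (\<integral>\<^sup>+\<xi>. ennreal (2 * cmod (fourier_int f \<xi> * (cnj (fourier_int g \<xi>) * complex_of_real (?w \<xi>)))) \<partial>lborel)"
      by (subst nn_integral_cmult[symmetric]) (auto simp: ennreal_mult)
    also have "\<dots> \<le> (\<integral>\<^sup>+\<xi>. ennreal ((cmod (fourier_int f \<xi>))\<^sup>2 + (cmod (fourier_int g \<xi>))\<^sup>2) \<partial>lborel)"
    proof (intro nn_integral_mono ennreal_leI)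
      fix \<xi>
      have "2 * (cmod (fourier_int f \<xi>) * cmod (fourier_int g \<xi>)) * ?w \<xi> \<le> ((cmod (fourier_int f \<xi>))\<^sup>2 + (cmod (fourier_int g \<xi>))\<^sup>2) * 1"
        using sum_squares_bound[of "cmod (fourier_int f \<xi>)" "cmod (fourier_int g \<xi>)"]
        by (intro mult_mono) (auto simp: mult.assoc)
      then show "2 * cmod (fourier_int f \<xi> * (cnj (fourier_int g \<xi>) * complex_of_real (?w \<xi>))) \<le> (cmod (fourier_int f \<xi>))\<^sup>2 + (cmod (fourier_int g \<xi>))\<^sup>2"
        by (simp add: norm_mult mult.assoc)
    qed
    also have "\<dots> = L2_energy (fourier_int f) + L2_energy (fourier_int g)"
      unfolding L2_energy_def by (simp add: nn_integral_add)
    also have "\<dots> \<le> L2_energy (fourier_int f) + L2_energy g"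
      by (intro add_left_mono L2_energy_fourier_int_le g)
    finally show ?thesis by (simp add: ennreal_mult)
  qed
  with lim show ?thesis by (intro LIMSEQ_le_const2[OF lim]) auto
qed

lemma integrable_bounded_support:
  fixes g :: "real \<Rightarrow> 'a :: {banach, second_countable_topology}"
  assumes [measurable]: "g \<in> borel_measurable borel" and B: "\<And>x. norm (g x) \<le> B"
    and z: "\<And>x. R \<le> \<bar>x\<bar> \<Longrightarrow> g x = 0"
  shows "integrable lborel g"
proof (rule Bochner_Integration.integrable_bound)
  show "integrable lborel (\<lambda>x. B * indicator {-R..R} x :: real)"
    by (intro integrable_mult_right integrable_real_indicator) (auto simp: emeasure_lborel_Icc_eq)
  have "0 \<le> B" using B[of 0] norm_ge_zero order_trans by blast
  then show "AE x in lborel. norm (g x) \<le> norm (B * indicator {-R..R} x :: real)"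
    using B z by (intro AE_I2) (auto simp: indicator_def abs_le_iff not_le)
qed simp

text \<open>Real and imaginary parts of \<open>g\<close> are approximated by continuous functions
  with the same bound and support; both the pairing and the energy converge by dominated
  convergence. The combined approximants are bounded by 2 B, one \<open>B\<close> for each
  part.\<close>

lemma pairing_le_bounded:
  assumes f: "integrable lborel f" and [measurable]: "g \<in> borel_measurable borel"
    and B: "\<And>x. cmod (g x) \<le> B" and z: "\<And>x. R \<le> \<bar>x\<bar> \<Longrightarrow> g x = 0"
  shows "ennreal (2 * cmod (\<integral>x. f x * cnj (g x) \<partial>lborel)) \<le> L2_energy (fourier_int f) + L2_energy g"
proof -
  have [measurable]: "f \<in> borel_measurable borel"
    using borel_measurable_integrable[OF f] by auto
  have B0: "0 \<le> B" using B[of 0] norm_ge_zero order_trans by blast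
  have re: "\<bar>Re (g x)\<bar> \<le> B" and im: "\<bar>Im (g x)\<bar> \<le> B" for x
    using B[of x] abs_Re_le_cmod[of "g x"] abs_Im_le_cmod[of "g x"] by linarith+
  obtain a where a: "\<And>n. continuous_on UNIV (a n)" "\<And>n x. \<bar>a n x\<bar> \<le> B" "\<And>n x. R \<le> \<bar>x\<bar> \<Longrightarrow> a n x = 0"
      "AE x in lborel. \<bar>x\<bar> < R \<longrightarrow> (\<lambda>n. a n x) \<longlonglongrightarrow> Re (g x)"
    by (rule bounded_measurable_limit_continuous[of "\<lambda>x. Re (g x)" B R]) (simp, rule re, blast)
  obtain b where b: "\<And>n. continuous_on UNIV (b n)" "\<And>n x. \<bar>b n x\<bar> \<le> B" "\<And>n x. R \<le> \<bar>x\<bar> \<Longrightarrow> b n x = 0"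
      "AE x in lborel. \<bar>x\<bar> < R \<longrightarrow> (\<lambda>n. b n x) \<longlonglongrightarrow> Im (g x)"
    by (rule bounded_measurable_limit_continuous[of "\<lambda>x. Im (g x)" B R]) (simp, rule im, blast)
  define h where "h = (\<lambda>n x. complex_of_real (a n x) + \<i> * complex_of_real (b n x))"
  have hc: "continuous_on UNIV (h n)" for n
    unfolding h_def by (intro continuous_intros a b)
  then have [measurable]: "h n \<in> borel_measurable borel" for n
    by (rule borel_measurable_continuous_onI)
  have hB: "cmod (h n x) \<le> 2 * B" for n x
    using norm_triangle_ineq[of "complex_of_real (a n x)" "\<i> * complex_of_real (b n x)"] a(2)[of n x] b(2)[of n x]
    by (simp add: h_def norm_mult)
  have h0: "h n x = 0" if "R \<le> \<bar>x\<bar>" for n x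
    using that by (simp add: h_def a b)
  have hi: "integrable lborel (h n)" for n
    by (rule integrable_bounded_support[OF _ hB h0]) auto
  have hlim: "AE x in lborel. (\<lambda>n. h n x) \<longlonglongrightarrow> g x"
    using a(4) b(4)
  proof eventually_elim
    case (elim x)
    show ?case
    proof (cases "\<bar>x\<bar> < R")
      case True
      with elim have "(\<lambda>n. complex_of_real (a n x) + \<i> * complex_of_real (b n x)) \<longlonglongrightarrow> complex_of_real (Re (g x)) + \<i> * complex_of_real (Im (g x))"
        by (intro tendsto_intros) auto
      then show ?thesis by (simp add: h_def complex_eq[symmetric])
    qed (simp add: h0 z)
  qed
  have ind: "integrable lborel (\<lambda>x. (2 * B)\<^sup>2 * indicator {-R..R} x :: real)"
    by (intro integrable_mult_right integrable_real_indicator) (auto simp: emeasure_lborel_Icc_eq)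
  have l1: "(\<lambda>n. \<integral>x. f x * cnj (h n x) \<partial>lborel) \<longlonglongrightarrow> (\<integral>x. f x * cnj (g x) \<partial>lborel)"
  proof (rule integral_dominated_convergence)
    show "integrable lborel (\<lambda>x. cmod (f x) * (2 * B))"
      by (intro integrable_mult_left integrable_norm f)
    show "AE x in lborel. (\<lambda>n. f x * cnj (h n x)) \<longlonglongrightarrow> f x * cnj (g x)"
      using hlim by eventually_elim (intro tendsto_intros)
    show "AE x in lborel. norm (f x * cnj (h n x)) \<le> cmod (f x) * (2 * B)" for n
      unfolding norm_mult by (intro AE_I2 mult_left_mono) (auto simp: hB)
  qed measurable
  have l2: "(\<lambda>n. L2_energy (h n)) \<longlonglongrightarrow> L2_energy g"
    unfolding L2_energy_def
  proof (rule nn_integral_dominated_convergence[where w="\<lambda>x. ennreal ((2 * B)\<^sup>2 * indicator {-R..R} x)"])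
    show "(\<integral>\<^sup>+ x. ennreal ((2 * B)\<^sup>2 * indicator {-R..R} x) \<partial>lborel) < \<infinity>"
      using ind by (simp add: nn_integral_eq_integral)
    show "AE x in lborel. ennreal ((cmod (h n x))\<^sup>2) \<le> ennreal ((2 * B)\<^sup>2 * indicator {-R..R} x)" for n
    proof (rule AE_I2, rule ennreal_leI)
      fix x
      show "(cmod (h n x))\<^sup>2 \<le> (2 * B)\<^sup>2 * indicator {-R..R} x"
        using power_mono[OF hB[of n x], of 2] h0[of x n] by (auto simp: indicator_def abs_le_iff not_le)
    qed
    show "AE x in lborel. (\<lambda>n. ennreal ((cmod (h n x))\<^sup>2)) \<longlonglongrightarrow> ennreal ((cmod (g x))\<^sup>2)"
      using hlim by eventually_elim (intro tendsto_intros tendsto_ennrealI)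
  qed measurable
  show ?thesis
  proof (rule LIMSEQ_le)
    show "(\<lambda>n. ennreal (2 * cmod (\<integral>x. f x * cnj (h n x) \<partial>lborel))) \<longlonglongrightarrow> ennreal (2 * cmod (\<integral>x. f x * cnj (g x) \<partial>lborel))"
      using l1 by (intro tendsto_intros tendsto_ennrealI)
    show "(\<lambda>n. L2_energy (fourier_int f) + L2_energy (h n)) \<longlonglongrightarrow> L2_energy (fourier_int f) + L2_energy g"
      using l2 by (intro tendsto_add tendsto_const)
  qed (use pairing_le_continuous[OF f hi hc hB] in auto)
qed

text \<open>Duality with \<open>f\<close> itself, cut to 0 where |f| > n. For this test function g
  the pairing with \<open>f\<close> equals the energy E of g, so the pairing bound reads 2 E \<le>
  \<open>L2_energy (fourier_int f)\<close> + E. Bounded compact support makes E finite and hence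
  cancellable; Fatou's lemma then lets n grow.\<close>

lemma L2_energy_le_fourier_int:
  assumes f: "integrable lborel f" and z: "\<And>x. R \<le> \<bar>x\<bar> \<Longrightarrow> f x = 0"
  shows "L2_energy f \<le> L2_energy (fourier_int f)"
  unfolding L2_energy_def[of f]
proof (rule nn_integral_le_limit)
  have [measurable]: "f \<in> borel_measurable borel"
    using borel_measurable_integrable[OF f] by auto
  define g where "g = (\<lambda>n x. if cmod (f x) \<le> real n then f x else 0)"
  have [measurable]: "g n \<in> borel_measurable borel" for n
    unfolding g_def by measurable
  have gB: "cmod (g n x) \<le> real n" for n x by (simp add: g_def)
  have gz: "g n x = 0" if "R \<le> \<bar>x\<bar>" for n x using z[OF that] by (simp add: g_def)
  show "(\<lambda>x. ennreal ((cmod (g n x))\<^sup>2)) \<in> borel_measurable lborel" for n by measurable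
  show "AE x in lborel. (\<lambda>n. ennreal ((cmod (g n x))\<^sup>2)) \<longlonglongrightarrow> ennreal ((cmod (f x))\<^sup>2)"
  proof (rule AE_I2, rule tendsto_eventually)
    fix x
    obtain n0 :: nat where "cmod (f x) < real n0" using reals_Archimedean2 by blast
    then show "eventually (\<lambda>n. ennreal ((cmod (g n x))\<^sup>2) = ennreal ((cmod (f x))\<^sup>2)) sequentially"
      by (intro eventually_sequentiallyI[of n0]) (auto simp: g_def)
  qed
  show "(\<integral>\<^sup>+x. ennreal ((cmod (g n x))\<^sup>2) \<partial>lborel) \<le> L2_energy (fourier_int f)" for n
  proof -
    have sq: "(cmod (g n x))\<^sup>2 \<le> (real n)\<^sup>2" for x by (intro power_mono gB) auto
    have i: "integrable lborel (\<lambda>x. (cmod (g n x))\<^sup>2)"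
      by (rule integrable_bounded_support[where R=R and B="(real n)\<^sup>2"]) (auto simp: gz sq)
    have e: "L2_energy (g n) = ennreal (\<integral>x. (cmod (g n x))\<^sup>2 \<partial>lborel)"
      unfolding L2_energy_def using i by (simp add: nn_integral_eq_integral)
    have "(\<integral>x. f x * cnj (g n x) \<partial>lborel) = (\<integral>x. complex_of_real ((cmod (g n x))\<^sup>2) \<partial>lborel)"
      by (intro Bochner_Integration.integral_cong) (auto simp: g_def complex_norm_square simp del: of_real_power)
    also have "\<dots> = complex_of_real (\<integral>x. (cmod (g n x))\<^sup>2 \<partial>lborel)"
      by (rule integral_complex_of_real)
    finally have "cmod (\<integral>x. f x * cnj (g n x) \<partial>lborel) = (\<integral>x. (cmod (g n x))\<^sup>2 \<partial>lborel)"
      by (simp add: integral_nonneg_AE)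
    then have "ennreal (2 * (\<integral>x. (cmod (g n x))\<^sup>2 \<partial>lborel)) \<le> L2_energy (fourier_int f) + L2_energy (g n)"
      using pairing_le_bounded[OF f, of "g n" "real n" R] gB gz by simp
    moreover have "ennreal (2 * (\<integral>x. (cmod (g n x))\<^sup>2 \<partial>lborel)) = L2_energy (g n) + L2_energy (g n)"
      unfolding e by (simp add: integral_nonneg_AE flip: ennreal_plus)
    ultimately have "L2_energy (g n) + L2_energy (g n) \<le> L2_energy (fourier_int f) + L2_energy (g n)" by simp
    then have "L2_energy (g n) \<le> L2_energy (fourier_int f)"
      using e by (simp add: ennreal_add_left_cancel_le add.commute)
    then show ?thesis by (simp add: L2_energy_def)
  qed
qed

subsection \<open>Approximable Fourier pairs\<close>

lemma sq_int_iff: "sq_int f \<longleftrightarrow> f \<in> borel_measurable borel \<and> L2_energy f < \<infinity>"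
  by (auto simp: sq_int_def L2_energy_def integrable_iff_bounded)

lemma L2_energy_diff_le:
  assumes [measurable]: "f \<in> borel_measurable borel" "g \<in> borel_measurable borel"
  shows "L2_energy (\<lambda>x. f x - g x) \<le> 2 * L2_energy f + 2 * L2_energy g"
  using L2_energy_add_le[of f "\<lambda>x. - g x"] by (simp add: L2_energy_def)

lemma L2_energy_diff_eq_l2_dist:
  assumes [measurable]: "f \<in> borel_measurable borel" "g \<in> borel_measurable borel"
    and "L2_energy f < \<infinity>" "L2_energy g < \<infinity>"
  shows "L2_energy (\<lambda>x. f x - g x) = ennreal ((l2_dist f g)\<^sup>2)"
proof -
  have "L2_energy (\<lambda>x. f x - g x) \<le> 2 * L2_energy f + 2 * L2_energy g"
    by (rule L2_energy_diff_le) auto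
  also have "\<dots> < \<infinity>" using assms(3,4) by (simp add: ennreal_mult_less_top)
  finally have "integrable lborel (\<lambda>x. (cmod (f x - g x))\<^sup>2)"
    by (simp add: L2_energy_def integrable_iff_bounded)
  then show ?thesis
    by (simp add: L2_energy_def l2_dist_def nn_integral_eq_integral integral_nonneg_AE)
qed

lemma fourier_int_add:
  assumes "integrable lborel f" "integrable lborel g"
  shows "fourier_int (\<lambda>x. f x + g x) \<xi> = fourier_int f \<xi> + fourier_int g \<xi>"
  unfolding fourier_int_def distrib_right
  by (subst Bochner_Integration.integral_add[OF integrable_mult_char integrable_mult_char, OF assms])
    (simp add: distrib_left)

lemma fourier_int_cmult: "fourier_int (\<lambda>x. c * f x) \<xi> = c * fourier_int f \<xi>"
  unfolding fourier_int_def mult.assoc integral_mult_right_zero by (rule mult.left_commute)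

lemma fourier_int_shift:
  "fourier_int (\<lambda>x. f (x - t)) \<xi> = exp (- \<i> * complex_of_real (\<xi> * t)) * fourier_int f \<xi>"
proof -
  have e: "exp (- (\<i> * (complex_of_real \<xi> * (complex_of_real t + complex_of_real x))))
     = exp (- (\<i> * (complex_of_real \<xi> * complex_of_real t))) * exp (- (\<i> * (complex_of_real \<xi> * complex_of_real x)))" for x
    by (simp add: exp_add[symmetric] algebra_simps)
  have "fourier_int (\<lambda>x. f (x - t)) \<xi> = complex_of_real (1 / sqrt (2 * pi)) *
     (\<integral>x. exp (- \<i> * complex_of_real (\<xi> * t)) * (f x * exp (- \<i> * complex_of_real (\<xi> * x))) \<partial>lborel)"
    unfolding fourier_int_def
    by (subst lborel_integral_real_affine[where c=1 and t=t]) (auto simp: e mult.left_commute)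
  then show ?thesis
    unfolding fourier_int_def integral_mult_right_zero by (simp only: mult.left_commute)
qed

lemma tendsto_ennreal_zero_le:
  fixes u v :: "'a \<Rightarrow> ennreal"
  assumes "(v \<longlongrightarrow> 0) F" "\<And>x. u x \<le> v x"
  shows "(u \<longlongrightarrow> 0) F"
  by (rule tendsto_sandwich[OF _ _ tendsto_const assms(1)]) (auto simp: assms(2))

text \<open>\<open>fourier_pair f F\<close> relaxes \<^const>\<open>l2_fourier\<close> to arbitrary compactly supported
  approximations of \<open>f\<close>; unlike truncation, these are stable under sums and translations.\<close>
definition fourier_pair :: "(real \<Rightarrow> complex) \<Rightarrow> (real \<Rightarrow> complex) \<Rightarrow> bool" where
  "fourier_pair f F \<longleftrightarrow> f \<in> borel_measurable borel \<and> F \<in> borel_measurable borel \<and>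
     (\<exists>u. (\<forall>n::nat. integrable lborel (u n) \<and> (\<exists>R. \<forall>x. R \<le> \<bar>x\<bar> \<longrightarrow> u n x = 0)) \<and>
        (\<lambda>n. L2_energy (\<lambda>x. u n x - f x)) \<longlonglongrightarrow> 0 \<and>
        (\<lambda>n. L2_energy (\<lambda>\<xi>. fourier_int (u n) \<xi> - F \<xi>)) \<longlonglongrightarrow> 0)"

lemma fourier_pairI:
  fixes u :: "nat \<Rightarrow> real \<Rightarrow> complex"
  assumes "f \<in> borel_measurable borel" "F \<in> borel_measurable borel"
    "\<And>n. integrable lborel (u n)" "\<And>n x. R n \<le> \<bar>x\<bar> \<Longrightarrow> u n x = 0"
    "(\<lambda>n. L2_energy (\<lambda>x. u n x - f x)) \<longlonglongrightarrow> 0"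
    "(\<lambda>n. L2_energy (\<lambda>\<xi>. fourier_int (u n) \<xi> - F \<xi>)) \<longlonglongrightarrow> 0"
  shows "fourier_pair f F"
  unfolding fourier_pair_def using assms by (intro conjI exI[of _ u]) auto

lemma fourier_pairE:
  assumes "fourier_pair f F"
  obtains u R where "f \<in> borel_measurable borel" "F \<in> borel_measurable borel"
    "\<And>n::nat. integrable lborel (u n)" "\<And>n. u n \<in> borel_measurable borel" "\<And>n x. R n \<le> \<bar>x\<bar> \<Longrightarrow> u n x = 0"
    "(\<lambda>n. L2_energy (\<lambda>x. u n x - f x)) \<longlonglongrightarrow> 0"
    "(\<lambda>n. L2_energy (\<lambda>\<xi>. fourier_int (u n) \<xi> - F \<xi>)) \<longlonglongrightarrow> 0"
proof -
  obtain u where m: "f \<in> borel_measurable borel" "F \<in> borel_measurable borel" and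
    u: "\<forall>n::nat. integrable lborel (u n) \<and> (\<exists>R. \<forall>x. R \<le> \<bar>x\<bar> \<longrightarrow> u n x = 0)"
    "(\<lambda>n. L2_energy (\<lambda>x. u n x - f x)) \<longlonglongrightarrow> 0"
    "(\<lambda>n. L2_energy (\<lambda>\<xi>. fourier_int (u n) \<xi> - F \<xi>)) \<longlonglongrightarrow> 0"
    using assms unfolding fourier_pair_def by blast
  then obtain R where "\<And>n x. R n \<le> \<bar>x\<bar> \<Longrightarrow> u n x = 0" by metis
  moreover have "u n \<in> borel_measurable borel" for n
    using borel_measurable_integrable[of lborel "u n"] u(1) by auto
  ultimately show thesis using that[of u R] m u by blast
qed

text \<open>The truncations of \<open>f\<close> serve as approximants: they converge to
  \<open>f\<close> by dominated convergence, and their transforms converge to \<open>F\<close> by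
  the definition of \<open>l2_fourier\<close>.\<close>

lemma fourier_pair_l2_fourier:
  assumes "l2_fourier f F"
  shows "fourier_pair f F"
proof (rule fourier_pairI)
  have m [measurable]: "f \<in> borel_measurable borel" "F \<in> borel_measurable borel"
    and fin: "L2_energy f < \<infinity>" "L2_energy F < \<infinity>"
    and lim: "(\<lambda>n::nat. l2_dist F (fourier_int (\<lambda>x. indicator {- real n..real n} x * f x))) \<longlonglongrightarrow> 0"
    using assms by (auto simp: l2_fourier_def sq_int_iff)
  let ?u = "\<lambda>n::nat. \<lambda>x. indicator {- real n..real n} x * f x"
  show "f \<in> borel_measurable borel" "F \<in> borel_measurable borel" by fact+
  have fi: "integrable lborel (\<lambda>x. (cmod (f x))\<^sup>2)"
    using assms by (auto simp: l2_fourier_def sq_int_def)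
  show int: "integrable lborel (?u n)" for n
  proof (rule Bochner_Integration.integrable_bound)
    show "integrable lborel (\<lambda>x. indicator {- real n..real n} x + (cmod (f x))\<^sup>2)"
      by (intro Bochner_Integration.integrable_add fi integrable_real_indicator) (auto simp: emeasure_lborel_Icc_eq)
    \<comment> \<open>On a bounded interval this inequality makes a square integrable function
      integrable.\<close>
    have "t \<le> 1 + t\<^sup>2" for t :: real using zero_le_power2[of "t - 1/2"] by (simp add: power2_diff field_simps)
    then show "AE x in lborel. norm (?u n x) \<le> norm (indicator {- real n..real n} x + (cmod (f x))\<^sup>2)"
      by (auto simp: indicator_def)
  qed measurable
  \<comment> \<open>The truncation interval is closed, so the function may be nonzero at |x| = n;
    the radius n + 1 makes it vanish from |x| = R n on, endpoint included.\<close>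
  show "real n + 1 \<le> \<bar>x\<bar> \<Longrightarrow> ?u n x = 0" for n x by (auto simp: indicator_def)
  have "(\<lambda>n. L2_energy (\<lambda>x. ?u n x - f x)) \<longlonglongrightarrow> (\<integral>\<^sup>+(x::real). 0 \<partial>lborel)"
    unfolding L2_energy_def
  proof (rule nn_integral_dominated_convergence[where w="\<lambda>x. ennreal ((cmod (f x))\<^sup>2)"])
    show "(\<integral>\<^sup>+ x. ennreal ((cmod (f x))\<^sup>2) \<partial>lborel) < \<infinity>" using fin by (simp add: L2_energy_def)
    show "AE x in lborel. ennreal ((cmod (?u n x - f x))\<^sup>2) \<le> ennreal ((cmod (f x))\<^sup>2)" for n
      by (intro AE_I2 ennreal_leI) (auto simp: indicator_def)
    show "AE x in lborel. (\<lambda>n. ennreal ((cmod (?u n x - f x))\<^sup>2)) \<longlonglongrightarrow> 0"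
    proof (rule AE_I2, rule tendsto_eventually)
      fix x :: real
      obtain n0 :: nat where "\<bar>x\<bar> < real n0" using reals_Archimedean2 by blast
      then show "eventually (\<lambda>n. ennreal ((cmod (?u n x - f x))\<^sup>2) = 0) sequentially"
        by (intro eventually_sequentiallyI[of n0]) (auto simp: indicator_def abs_less_iff)
    qed
  qed measurable
  then show "(\<lambda>n. L2_energy (\<lambda>x. ?u n x - f x)) \<longlonglongrightarrow> 0" by simp
  have "L2_energy (\<lambda>\<xi>. fourier_int (?u n) \<xi> - F \<xi>) = ennreal ((l2_dist F (fourier_int (?u n)))\<^sup>2)" for n
  proof -
    have "L2_energy (?u n) \<le> L2_energy f"
      unfolding L2_energy_def by (intro nn_integral_mono ennreal_leI) (auto simp: indicator_def)
    then have "L2_energy (fourier_int (?u n)) < \<infinity>"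
      using L2_energy_fourier_int_le[OF int, of n] fin by (meson le_less_trans)
    then have "L2_energy (\<lambda>\<xi>. F \<xi> - fourier_int (?u n) \<xi>) = ennreal ((l2_dist F (fourier_int (?u n)))\<^sup>2)"
      by (intro L2_energy_diff_eq_l2_dist fin) measurable
    then show ?thesis
      using L2_energy_cong[of "\<lambda>\<xi>. fourier_int (?u n) \<xi> - F \<xi>" "\<lambda>\<xi>. F \<xi> - fourier_int (?u n) \<xi>"]
      by (simp add: norm_minus_commute)
  qed
  moreover have "(\<lambda>n. ennreal ((l2_dist F (fourier_int (?u n)))\<^sup>2)) \<longlonglongrightarrow> ennreal (0\<^sup>2)"
    by (intro tendsto_ennrealI tendsto_power lim)
  ultimately show "(\<lambda>n. L2_energy (\<lambda>\<xi>. fourier_int (?u n) \<xi> - F \<xi>)) \<longlonglongrightarrow> 0" by simp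
qed

lemma fourier_pair_add:
  assumes "fourier_pair f F" "fourier_pair g G"
  shows "fourier_pair (\<lambda>x. f x + g x) (\<lambda>\<xi>. F \<xi> + G \<xi>)"
proof -
  obtain u R where u [measurable]: "f \<in> borel_measurable borel" "F \<in> borel_measurable borel"
    and ui: "\<And>n::nat. integrable lborel (u n)" and um [measurable]: "\<And>n. u n \<in> borel_measurable borel"
    and uR: "\<And>n x. R n \<le> \<bar>x\<bar> \<Longrightarrow> u n x = 0"
    and ul: "(\<lambda>n. L2_energy (\<lambda>x. u n x - f x)) \<longlonglongrightarrow> 0"
    "(\<lambda>n. L2_energy (\<lambda>\<xi>. fourier_int (u n) \<xi> - F \<xi>)) \<longlonglongrightarrow> 0"
    by (fact fourier_pairE[OF assms(1)])
  obtain v S where v [measurable]: "g \<in> borel_measurable borel" "G \<in> borel_measurable borel"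
    and vi: "\<And>n::nat. integrable lborel (v n)" and vm [measurable]: "\<And>n. v n \<in> borel_measurable borel"
    and vR: "\<And>n x. S n \<le> \<bar>x\<bar> \<Longrightarrow> v n x = 0"
    and vl: "(\<lambda>n. L2_energy (\<lambda>x. v n x - g x)) \<longlonglongrightarrow> 0"
    "(\<lambda>n. L2_energy (\<lambda>\<xi>. fourier_int (v n) \<xi> - G \<xi>)) \<longlonglongrightarrow> 0"
    by (fact fourier_pairE[OF assms(2)])
  have z: "(\<lambda>n. 2 * a n + 2 * b n) \<longlonglongrightarrow> 0" if "a \<longlonglongrightarrow> 0" "b \<longlonglongrightarrow> 0" for a b :: "nat \<Rightarrow> ennreal"
  proof -
    have "(\<lambda>n. 2 * a n + 2 * b n) \<longlonglongrightarrow> 2 * 0 + 2 * 0"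
      by (intro tendsto_add ennreal_tendsto_cmult that) auto
    then show ?thesis by simp
  qed
  show ?thesis
  proof (rule fourier_pairI[where u="\<lambda>n x. u n x + v n x" and R="\<lambda>n. max (R n) (S n)"])
    show "integrable lborel (\<lambda>x. u n x + v n x)" for n
      by (intro Bochner_Integration.integrable_add ui vi)
    have "L2_energy (\<lambda>x. (u n x - f x) + (v n x - g x)) \<le> 2 * L2_energy (\<lambda>x. u n x - f x) + 2 * L2_energy (\<lambda>x. v n x - g x)" for n
      by (rule L2_energy_add_le) measurable
    then show "(\<lambda>n. L2_energy (\<lambda>x. u n x + v n x - (f x + g x))) \<longlonglongrightarrow> 0"
      by (intro tendsto_ennreal_zero_le[OF z[OF ul(1) vl(1)]]) (simp add: algebra_simps)
    have "L2_energy (\<lambda>x. (fourier_int (u n) x - F x) + (fourier_int (v n) x - G x))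
       \<le> 2 * L2_energy (\<lambda>x. fourier_int (u n) x - F x) + 2 * L2_energy (\<lambda>x. fourier_int (v n) x - G x)" for n
      by (rule L2_energy_add_le) measurable
    then show "(\<lambda>n. L2_energy (\<lambda>\<xi>. fourier_int (\<lambda>x. u n x + v n x) \<xi> - (F \<xi> + G \<xi>))) \<longlonglongrightarrow> 0"
      by (intro tendsto_ennreal_zero_le[OF z[OF ul(2) vl(2)]]) (simp add: fourier_int_add ui vi algebra_simps)
  qed (auto simp: uR vR)
qed

text \<open>Translation enlarges the support radius by at most |t| and multiplies the transform by a
  function of modulus 1, so both errors are only scaled by |c|^2.\<close>

lemma fourier_pair_cmult_shift:
  assumes "fourier_pair f F"
  shows "fourier_pair (\<lambda>x. c * f (x - t)) (\<lambda>\<xi>. c * (exp (- \<i> * complex_of_real (\<xi> * t)) * F \<xi>))"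
proof -
  obtain u R where u [measurable]: "f \<in> borel_measurable borel" "F \<in> borel_measurable borel"
    and ui: "\<And>n::nat. integrable lborel (u n)" and um [measurable]: "\<And>n. u n \<in> borel_measurable borel"
    and uR: "\<And>n x. R n \<le> \<bar>x\<bar> \<Longrightarrow> u n x = 0"
    and ul: "(\<lambda>n. L2_energy (\<lambda>x. u n x - f x)) \<longlonglongrightarrow> 0"
    "(\<lambda>n. L2_energy (\<lambda>\<xi>. fourier_int (u n) \<xi> - F \<xi>)) \<longlonglongrightarrow> 0"
    by (fact fourier_pairE[OF assms(1)])
  have z: "(\<lambda>n. ennreal ((cmod c)\<^sup>2) * a n) \<longlonglongrightarrow> 0" if "a \<longlonglongrightarrow> 0" for a :: "nat \<Rightarrow> ennreal"
    using ennreal_tendsto_cmult[OF _ that, of "ennreal ((cmod c)\<^sup>2)"] by simp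
  show ?thesis
  proof (rule fourier_pairI[where u="\<lambda>n x. c * u n (x - t)" and R="\<lambda>n. R n + \<bar>t\<bar>"])
    show "integrable lborel (\<lambda>x. c * u n (x - t))" for n
      using lborel_integrable_real_affine[OF ui[of n], of 1 "-t"] by (intro integrable_mult_right) simp
    show "c * u n (x - t) = 0" if "R n + \<bar>t\<bar> \<le> \<bar>x\<bar>" for n x
      using that uR[of n "x - t"] by auto
    have "L2_energy (\<lambda>x. c * (u n (x - t) - f (x - t))) = ennreal ((cmod c)\<^sup>2) * L2_energy (\<lambda>x. u n x - f x)" for n
      by (simp add: L2_energy_cmult L2_energy_shift[where f="\<lambda>x. u n x - f x"])
    then show "(\<lambda>n. L2_energy (\<lambda>x. c * u n (x - t) - c * f (x - t))) \<longlonglongrightarrow> 0"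
      using z[OF ul(1)] by (simp add: right_diff_distrib)
    have "L2_energy (\<lambda>\<xi>. fourier_int (\<lambda>x. c * u n (x - t)) \<xi> - c * (exp (- \<i> * complex_of_real (\<xi> * t)) * F \<xi>))
       = L2_energy (\<lambda>\<xi>. c * (fourier_int (u n) \<xi> - F \<xi>))" for n
      by (rule L2_energy_cong)
        (simp add: fourier_int_cmult fourier_int_shift norm_mult flip: right_diff_distrib)
    then show "(\<lambda>n. L2_energy (\<lambda>\<xi>. fourier_int (\<lambda>x. c * u n (x - t)) \<xi> - c * (exp (- \<i> * complex_of_real (\<xi> * t)) * F \<xi>))) \<longlonglongrightarrow> 0"
      using z[OF ul(2)] by (simp add: L2_energy_cmult)
  qed measurable
qed

lemma fourier_pair_zero: "fourier_pair (\<lambda>x. 0) (\<lambda>\<xi>. 0)"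
  by (rule fourier_pairI[where u="\<lambda>n x. 0" and R="\<lambda>n. 0"]) (auto simp: L2_energy_def fourier_int_def)

lemma fourier_pair_sum:
  assumes "finite J" "fourier_pair f F"
  shows "fourier_pair (\<lambda>x. \<Sum>j\<in>J. c j * f (x - real_of_int j))
    (\<lambda>\<xi>. (\<Sum>j\<in>J. c j * exp (- \<i> * complex_of_real (\<xi> * real_of_int j))) * F \<xi>)"
  using assms(1)
proof induction
  case empty show ?case using fourier_pair_zero by simp
next
  case (insert j J)
  from fourier_pair_add[OF fourier_pair_cmult_shift[OF assms(2), of "c j" "real_of_int j"] insert.IH] insert.hyps
  show ?case by (simp add: distrib_right mult.assoc)
qed

text \<open>The reverse Plancherel inequality holds for the compactly supported approximants and
  passes to the limit. The constant 4 is the cost of two squared triangle inequalities, one on each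
  side of the transform.\<close>

lemma L2_energy_fourier_pair_le:
  assumes "fourier_pair f F"
  shows "L2_energy f \<le> 4 * L2_energy F"
proof -
  obtain u R where u [measurable]: "f \<in> borel_measurable borel" "F \<in> borel_measurable borel"
    and ui: "\<And>n::nat. integrable lborel (u n)" and um [measurable]: "\<And>n. u n \<in> borel_measurable borel"
    and uR: "\<And>n x. R n \<le> \<bar>x\<bar> \<Longrightarrow> u n x = 0"
    and ul: "(\<lambda>n. L2_energy (\<lambda>x. u n x - f x)) \<longlonglongrightarrow> 0"
    "(\<lambda>n. L2_energy (\<lambda>\<xi>. fourier_int (u n) \<xi> - F \<xi>)) \<longlonglongrightarrow> 0"
    by (fact fourier_pairE[OF assms(1)])
  have "L2_energy f \<le> 2 * L2_energy (\<lambda>x. u n x - f x) + 2 * (2 * L2_energy (\<lambda>\<xi>. fourier_int (u n) \<xi> - F \<xi>) + 2 * L2_energy F)" for n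
  proof -
    have "L2_energy (\<lambda>x. (u n x - f x) - u n x) \<le> 2 * L2_energy (\<lambda>x. u n x - f x) + 2 * L2_energy (u n)"
      by (rule L2_energy_diff_le) measurable
    also have "L2_energy (u n) \<le> L2_energy (fourier_int (u n))"
      by (rule L2_energy_le_fourier_int[OF ui uR])
    also have "L2_energy (fourier_int (u n)) = L2_energy (\<lambda>\<xi>. (fourier_int (u n) \<xi> - F \<xi>) + F \<xi>)"
      by simp
    also have "\<dots> \<le> 2 * L2_energy (\<lambda>\<xi>. fourier_int (u n) \<xi> - F \<xi>) + 2 * L2_energy F"
      by (rule L2_energy_add_le) measurable
    also have "L2_energy (\<lambda>x. (u n x - f x) - u n x) = L2_energy f"
      by (rule L2_energy_cong) simp
    finally show ?thesis by (simp add: mult_left_mono add_left_mono)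
  qed
  moreover have "(\<lambda>n. 2 * L2_energy (\<lambda>x. u n x - f x) + 2 * (2 * L2_energy (\<lambda>\<xi>. fourier_int (u n) \<xi> - F \<xi>) + 2 * L2_energy F))
      \<longlonglongrightarrow> 2 * 0 + 2 * (2 * 0 + 2 * L2_energy F)"
    by (intro tendsto_add ennreal_tendsto_cmult ul tendsto_const) auto
  ultimately have "L2_energy f \<le> 2 * 0 + 2 * (2 * 0 + 2 * L2_energy F)"
    by (intro LIMSEQ_le_const) auto
  then show ?thesis by (simp add: mult.assoc[symmetric])
qed

subsection \<open>Positive definite functions\<close>

text \<open>For 0 \<le> w \<le> 1 the product |f| w is at most w where |f| \<le> 1 and at most |f|^2
  elsewhere, so |f|^2 plus the Gaussian is an integrable majorant.\<close>

lemma sq_int_mult_gauss_integrable: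
  assumes "sq_int f" and s: "0 < s"
  shows "integrable lborel (\<lambda>x. f x * complex_of_real (exp (- (s * x)\<^sup>2 / 2)))"
proof -
  have [measurable]: "f \<in> borel_measurable borel" using assms by (simp add: sq_int_iff)
  have 1: "integrable lborel (\<lambda>x. (cmod (f x))\<^sup>2 + exp (- (s * x)\<^sup>2 / 2))"
    using assms integrable_gauss[OF s] by (auto simp: sq_int_def)
  have "cmod (f x) * w \<le> (cmod (f x))\<^sup>2 + w" if "0 \<le> w" "w \<le> 1" for x and w :: real
  proof (cases "cmod (f x) \<le> 1")
    case True then show ?thesis using that mult_right_mono[OF True that(1)] by (simp add: add_increasing)
  next
    case False
    then have "cmod (f x) * w \<le> cmod (f x) * cmod (f x)" using that by (intro mult_left_mono) auto
    then show ?thesis using that by (simp add: power2_eq_square add_increasing2)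
  qed
  then have "AE x in lborel. norm (f x * complex_of_real (exp (- (s * x)\<^sup>2 / 2))) \<le> norm ((cmod (f x))\<^sup>2 + exp (- (s * x)\<^sup>2 / 2))"
    by (auto simp: norm_mult)
  then show ?thesis by (intro Bochner_Integration.integrable_bound[OF 1]) measurable
qed

text \<open>The joint law of all coordinates is the product measure itself, which is the product of
  their marginals; independence of the family restricts to the two chosen coordinates.\<close>

lemma indep_var_PiM_coordinates:
  assumes N: "\<And>i::'i. prob_space (N i)" and S: "\<And>i. sets (N i) = sets (borel :: real measure)" and jk: "j \<noteq> k"
  shows "prob_space.indep_var (PiM UNIV N) borel (\<lambda>\<omega>. \<omega> j) borel (\<lambda>\<omega>. \<omega> k)"
proof -
  let ?M = "PiM UNIV N"
  interpret prob_space ?M by (intro prob_space_PiM N)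
  have m: "(\<lambda>\<omega>. \<omega> i) \<in> borel_measurable ?M" for i
    using measurable_component_singleton[of i UNIV N] S by (simp cong: measurable_cong_sets)
  have d: "distr ?M borel (\<lambda>\<omega>. \<omega> i) = N i" for i
    using distr_PiM_component[of UNIV N i] N S by (simp cong: distr_cong)
  have "distr ?M (PiM UNIV (\<lambda>i. borel)) (\<lambda>x. x) = ?M"
    by (rule distr_id2) (intro sets_PiM_cong, auto simp: S)
  then have "indep_vars (\<lambda>_. borel) (\<lambda>i \<omega>. \<omega> i) UNIV"
    using m by (subst indep_vars_iff_distr_eq_PiM') (auto simp: d restrict_def)
  from indep_var_restrict[OF this, of "{j}" "{k}"] jk
  have "indep_var (PiM {j} (\<lambda>_. borel)) (\<lambda>\<omega>. restrict (\<lambda>i. \<omega> i) {j}) (PiM {k} (\<lambda>_. borel)) (\<lambda>\<omega>. restrict (\<lambda>i. \<omega> i) {k})"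
    by auto
  from indep_var_compose[OF this, of "\<lambda>f. f j" borel "\<lambda>f. f k" borel] show ?thesis
    by (simp add: comp_def measurable_component_singleton)
qed

text \<open>Averaging the positivity condition over \<open>n\<close> independent normal points gives
  \<open>n \<phi>(0) + n (n - 1) A \<ge> 0\<close>, where \<open>A\<close> is the integral below, since the difference of two
  independent normal variables is normal. No continuity of \<open>\<phi>\<close> is needed.\<close>
lemma pos_def_fun_normal_integral:
  fixes \<xi> :: real
  assumes pd: "pos_def_fun \<phi>" and sq: "sq_int \<phi>" and s: "0 < s"
  defines "A \<equiv> \<integral>x. normal_density 0 s x *\<^sub>R (\<phi> x * exp (- \<i> * complex_of_real (\<xi> * x))) \<partial>lborel"
  shows "Im A = 0" "0 \<le> Re A"
proof -
  have m [measurable]: "\<phi> \<in> borel_measurable borel" using sq by (simp add: sq_int_iff)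
  let ?\<psi> = "\<lambda>x. \<phi> x * exp (- \<i> * complex_of_real (\<xi> * x))"
  \<comment> \<open>Two independent centred normals of deviation s / sqrt 2 differ by a normal
    variable of deviation exactly \<open>s\<close>.\<close>
  let ?t = "s / sqrt 2"
  let ?N = "density lborel (normal_density 0 ?t)"
  let ?M = "PiM UNIV (\<lambda>_::nat. ?N)"
  have t: "0 < ?t" using s by simp
  interpret prob_space ?M by (rule prob_space_PiM, rule prob_space_normal_density[OF t])
  have mc [measurable]: "(\<lambda>\<omega>. \<omega> i) \<in> borel_measurable ?M" for i
    using measurable_component_singleton[of i UNIV "\<lambda>_. ?N"] by (simp cong: measurable_cong_sets)
  have dist1: "distributed ?M lborel (\<lambda>\<omega>. \<omega> i) (normal_density 0 ?t)" for i
  proof -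
    have "distr ?M lborel (\<lambda>\<omega>. \<omega> i) = ?N"
      using distr_PiM_component[of UNIV "\<lambda>_. ?N" i] prob_space_normal_density[OF t] by (simp cong: distr_cong)
    then show ?thesis by (simp add: distributed_def)
  qed
  have dist: "distributed ?M lborel (\<lambda>\<omega>. \<omega> j - \<omega> k) (normal_density 0 s)" if "j \<noteq> k" for j k
  proof -
    have "sqrt (?t\<^sup>2 + ?t\<^sup>2) = s" using s by (simp add: power_divide)
    then show ?thesis
      using diff_indep_normal[OF indep_var_PiM_coordinates[OF _ _ that] t t dist1[of j] dist1[of k]]
        prob_space_normal_density[OF t] by simp
  qed
  have psi_int: "integrable lborel (\<lambda>x. normal_density 0 s x *\<^sub>R ?\<psi> x)"
  proof -
    have "integrable lborel (\<lambda>x. \<phi> x * complex_of_real (exp (- (1 / s * x)\<^sup>2 / 2)))"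
      using s by (intro sq_int_mult_gauss_integrable sq) auto
    then have "integrable lborel (\<lambda>x. complex_of_real (1 / sqrt (2 * pi * s\<^sup>2)) * (\<phi> x * complex_of_real (exp (- (1 / s * x)\<^sup>2 / 2)) * exp (- \<i> * complex_of_real (\<xi> * x))))"
      by (intro integrable_mult_right integrable_mult_char)
    moreover have "(\<lambda>x. complex_of_real (1 / sqrt (2 * pi * s\<^sup>2)) * (\<phi> x * complex_of_real (exp (- (1 / s * x)\<^sup>2 / 2)) * exp (- \<i> * complex_of_real (\<xi> * x))))
       = (\<lambda>x. normal_density 0 s x *\<^sub>R ?\<psi> x)"
      by (auto simp: fun_eq_iff normal_density_def scaleR_conv_of_real power_divide)
    ultimately show ?thesis by simp
  qed
  \<comment> \<open>Off the diagonal the law of the difference gives A; on the diagonal the argument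
    is 0 and the integrand is the constant \<open>\<phi> 0\<close>.\<close>
  have int: "integrable ?M (\<lambda>\<omega>. ?\<psi> (\<omega> j - \<omega> k)) \<and> (\<integral>\<omega>. ?\<psi> (\<omega> j - \<omega> k) \<partial>?M) = (if j = k then \<phi> 0 else A)" for j k
  proof (cases "j = k")
    case True then show ?thesis by (simp add: prob_space)
  next
    case False
    note D = dist[OF False, unfolded distributed_def]
    have "integrable (distr ?M lborel (\<lambda>\<omega>. \<omega> j - \<omega> k)) ?\<psi>"
      using psi_int D by (simp add: integrable_density)
    moreover have "(\<integral>x. ?\<psi> x \<partial>distr ?M lborel (\<lambda>\<omega>. \<omega> j - \<omega> k)) = A"
      using D by (simp add: integral_density A_def)
    ultimately show ?thesis
      using False by (simp add: integrable_distr_eq integral_distr)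
  qed
  have main: "Im (complex_of_real (real n) * \<phi> 0 + complex_of_real (real n * (real n - 1)) * A) = 0 \<and>
     0 \<le> Re (complex_of_real (real n) * \<phi> 0 + complex_of_real (real n * (real n - 1)) * A)" for n
  proof -
    let ?S = "\<lambda>\<omega>. \<Sum>j<n. \<Sum>k<n. ?\<psi> (\<omega> j - \<omega> k)"
    have S: "Im (?S \<omega>) = 0 \<and> 0 \<le> Re (?S \<omega>)" for \<omega>
    proof -
      \<comment> \<open>These unimodular coefficients absorb the character, so positive definiteness
        of \<open>\<phi>\<close> applies to its modulation \<open>?\<psi>\<close>.\<close>
      let ?c = "\<lambda>j. exp (- \<i> * complex_of_real (\<xi> * \<omega> j))"
      have "?S \<omega> = (\<Sum>j<n. \<Sum>k<n. ?c j * cnj (?c k) * \<phi> (\<omega> j - \<omega> k))"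
        by (intro sum.cong refl) (simp add: exp_cnj exp_diff exp_minus field_simps)
      moreover have "Im (\<Sum>j<n. \<Sum>k<n. ?c j * cnj (?c k) * \<phi> (\<omega> j - \<omega> k)) = 0 \<and> 0 \<le> Re (\<Sum>j<n. \<Sum>k<n. ?c j * cnj (?c k) * \<phi> (\<omega> j - \<omega> k))"
        by (rule pd[unfolded pos_def_fun_def Let_def, THEN spec[of _ n], THEN spec[of _ \<omega>], THEN spec[of _ ?c]])
      ultimately show ?thesis by (simp only:)
    qed
    have i: "integrable ?M ?S" using int by (intro Bochner_Integration.integrable_sum) auto
    have "(\<integral>\<omega>. ?S \<omega> \<partial>?M) = (\<Sum>j<n. \<Sum>k<n. if j = k then \<phi> 0 else A)"
    proof (subst Bochner_Integration.integral_sum)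
      show "integrable ?M (\<lambda>\<omega>. \<Sum>k<n. ?\<psi> (\<omega> j - \<omega> k))" for j
        using int by (intro Bochner_Integration.integrable_sum) blast
      have "(\<integral>\<omega>. (\<Sum>k<n. ?\<psi> (\<omega> j - \<omega> k)) \<partial>?M) = (\<Sum>k<n. if j = k then \<phi> 0 else A)" for j
        by (subst Bochner_Integration.integral_sum) (rule int[THEN conjunct1], simp only: int[THEN conjunct2])
      then show "(\<Sum>j<n. \<integral>\<omega>. (\<Sum>k<n. ?\<psi> (\<omega> j - \<omega> k)) \<partial>?M) = (\<Sum>j<n. \<Sum>k<n. if j = k then \<phi> 0 else A)"
        by (simp only:)
    qed
    also have "\<dots> = (\<Sum>j<n. \<phi> 0 + complex_of_real (real n - 1) * A)"
    proof (rule sum.cong[OF refl])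
      fix j assume j: "j \<in> {..<n}"
      have "(\<Sum>k<n. if j = k then \<phi> 0 else A) = (\<Sum>k<n. A + (if j = k then \<phi> 0 - A else 0))"
        by (intro sum.cong) auto
      also have "\<dots> = \<phi> 0 + complex_of_real (real n - 1) * A"
        using j by (simp add: sum.distrib algebra_simps)
      finally show "(\<Sum>k<n. if j = k then \<phi> 0 else A) = \<dots>" .
    qed
    also have "\<dots> = complex_of_real (real n) * \<phi> 0 + complex_of_real (real n * (real n - 1)) * A"
      by (simp add: algebra_simps)
    finally have e: "(\<integral>\<omega>. ?S \<omega> \<partial>?M) = \<dots>" .
    have "Im (\<integral>\<omega>. ?S \<omega> \<partial>?M) = (\<integral>\<omega>. Im (?S \<omega>) \<partial>?M)"
      using i by (rule integral_Im[symmetric])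
    also have "(\<lambda>\<omega>. Im (?S \<omega>)) = (\<lambda>\<omega>. 0)" using S by blast
    finally have im: "Im (\<integral>\<omega>. ?S \<omega> \<partial>?M) = 0" by simp
    have "Re (\<integral>\<omega>. ?S \<omega> \<partial>?M) = (\<integral>\<omega>. Re (?S \<omega>) \<partial>?M)"
      using i by (rule integral_Re[symmetric])
    moreover have "0 \<le> (\<integral>\<omega>. Re (?S \<omega>) \<partial>?M)"
      using S by (intro integral_nonneg_AE AE_I2) blast
    ultimately have "0 \<le> Re (\<integral>\<omega>. ?S \<omega> \<partial>?M)" by (simp only:)
    with im show ?thesis unfolding e by simp
  qed
  \<comment> \<open>One point shows that \<open>\<phi> 0\<close> is real; two points then show that
    A is real.\<close>
  show "Im A = 0" using main[of 1] main[of 2] by simp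
  show "0 \<le> Re A"
  proof (rule ccontr)
    assume "\<not> 0 \<le> Re A"
    then have A: "Re A < 0" by simp
    \<comment> \<open>With n + 1 points the average is (n + 1) (\<phi>(0) + n A), so a negative real
      part of A would prevail for large n.\<close>
    obtain n :: nat where n: "Re (\<phi> 0) / (- Re A) < real n" using reals_Archimedean2 by blast
    then have "Re (\<phi> 0) + real n * Re A < 0" using A by (simp add: field_simps)
    then have "real (Suc n) * (Re (\<phi> 0) + real n * Re A) < 0" by (intro mult_pos_neg) auto
    moreover have "0 \<le> real (Suc n) * (Re (\<phi> 0) + real n * Re A)"
      using main[of "Suc n"] by (simp add: algebra_simps)
    ultimately show False by simp
  qed
qed

text \<open>Multiplying \<open>\<phi>\<close> by a wide Gaussian gives integrable functions
  \<open>v n\<close> whose transforms are, up to a positive factor, the normal integrals already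
  known to be nonnegative. They converge to \<open>\<phi>\<close> in L2. Comparison with the
  approximants \<open>u n\<close> of the Fourier pair, through the contraction inequality, carries
  the convergence to the transforms, so \<open>\<Phi>\<close> is an L2 limit of nonnegative
  functions.\<close>

lemma fourier_pair_pos_def_fun_nonneg:
  assumes pd: "pos_def_fun \<phi>" and sq: "sq_int \<phi>" and F: "fourier_pair \<phi> \<Phi>"
  shows "AE \<xi> in lborel. \<Phi> \<xi> = complex_of_real (Re (\<Phi> \<xi>)) \<and> 0 \<le> Re (\<Phi> \<xi>)"
proof -
  obtain u R where [measurable]: "\<phi> \<in> borel_measurable borel" "\<Phi> \<in> borel_measurable borel"
    and ui: "\<And>n::nat. integrable lborel (u n)" and um [measurable]: "\<And>n. u n \<in> borel_measurable borel"
    and uR: "\<And>n x. R n \<le> \<bar>x\<bar> \<Longrightarrow> u n x = 0"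
    and ul: "(\<lambda>n. L2_energy (\<lambda>x. u n x - \<phi> x)) \<longlonglongrightarrow> 0"
    "(\<lambda>n. L2_energy (\<lambda>\<xi>. fourier_int (u n) \<xi> - \<Phi> \<xi>)) \<longlonglongrightarrow> 0"
    by (fact fourier_pairE[OF F])
  define v where "v = (\<lambda>n x. \<phi> x * complex_of_real (exp (- (1 / real (Suc n) * x)\<^sup>2 / 2)))"
  have vi: "integrable lborel (v n)" for n
    unfolding v_def by (intro sq_int_mult_gauss_integrable sq) auto
  have [measurable]: "v n \<in> borel_measurable borel" for n unfolding v_def by measurable
  have vpos: "fourier_int (v n) \<xi> = complex_of_real (Re (fourier_int (v n) \<xi>)) \<and> 0 \<le> Re (fourier_int (v n) \<xi>)" for n \<xi>
  proof -
    let ?s = "real (Suc n)"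
    define A where "A = (\<integral>x. normal_density 0 ?s x *\<^sub>R (\<phi> x * exp (- \<i> * complex_of_real (\<xi> * x))) \<partial>lborel)"
    have A: "Im A = 0" "0 \<le> Re A"
      unfolding A_def by (rule pos_def_fun_normal_integral[OF pd sq]; simp)+
    \<comment> \<open>The weight of \<open>v n\<close> is a normal density of deviation n + 1
      without its normalizing factor.\<close>
    have k: "complex_of_real (sqrt (2 * pi * ?s\<^sup>2)) * (normal_density 0 ?s x *\<^sub>R z) = complex_of_real (exp (- (1 / ?s * x)\<^sup>2 / 2)) * z" for x z
    proof -
      have "sqrt (2 * pi * ?s\<^sup>2) * normal_density 0 ?s x = exp (- (1 / ?s * x)\<^sup>2 / 2)"
        by (simp add: normal_density_def power_divide mult.commute del: of_nat_Suc)
      then show ?thesis by (simp only: scaleR_conv_of_real mult.assoc[symmetric] of_real_mult[symmetric])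
    qed
    have "fourier_int (v n) \<xi> = complex_of_real (1 / sqrt (2 * pi)) * (\<integral>x. complex_of_real (sqrt (2 * pi * ?s\<^sup>2)) * (normal_density 0 ?s x *\<^sub>R (\<phi> x * exp (- \<i> * complex_of_real (\<xi> * x)))) \<partial>lborel)"
      unfolding fourier_int_def
      unfolding k by (simp add: v_def mult_ac)
    also have "\<dots> = complex_of_real (1 / sqrt (2 * pi) * sqrt (2 * pi * ?s\<^sup>2)) * A"
      unfolding A_def integral_mult_right_zero by simp
    finally have e: "fourier_int (v n) \<xi> = complex_of_real (1 / sqrt (2 * pi) * sqrt (2 * pi * ?s\<^sup>2)) * A" .
    have "0 \<le> 1 / sqrt (2 * pi) * sqrt (2 * pi * ?s\<^sup>2)" by simp
    then show ?thesis unfolding e using A by (auto simp: complex_eq_iff mult_nonneg_nonneg simp del: of_real_mult)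
  qed
  have "(\<lambda>n. L2_energy (\<lambda>x. v n x - \<phi> x)) \<longlonglongrightarrow> (\<integral>\<^sup>+(x::real). 0 \<partial>lborel)"
    unfolding L2_energy_def
  proof (rule nn_integral_dominated_convergence[where w="\<lambda>x. ennreal ((cmod (\<phi> x))\<^sup>2)"])
    show "(\<integral>\<^sup>+ x. ennreal ((cmod (\<phi> x))\<^sup>2) \<partial>lborel) < \<infinity>" using sq by (simp add: sq_int_iff L2_energy_def)
    show "AE x in lborel. ennreal ((cmod (v n x - \<phi> x))\<^sup>2) \<le> ennreal ((cmod (\<phi> x))\<^sup>2)" for n
    proof (intro AE_I2 ennreal_leI power_mono)
      fix x
      let ?e = "exp (- (1 / real (Suc n) * x)\<^sup>2 / 2)"
      have "v n x - \<phi> x = \<phi> x * complex_of_real (?e - 1)" by (simp add: v_def algebra_simps)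
      then have "cmod (v n x - \<phi> x) = cmod (\<phi> x) * \<bar>?e - 1\<bar>" by (simp only: norm_mult norm_of_real)
      also have "\<dots> \<le> cmod (\<phi> x) * 1"
        using exp_gt_zero[of "- (1 / real (Suc n) * x)\<^sup>2 / 2"] by (intro mult_left_mono) (auto simp: abs_le_iff)
      finally show "cmod (v n x - \<phi> x) \<le> cmod (\<phi> x)" by simp
    qed auto
    show "AE x in lborel. (\<lambda>n. ennreal ((cmod (v n x - \<phi> x))\<^sup>2)) \<longlonglongrightarrow> 0"
    proof (rule AE_I2)
      fix x
      have "(\<lambda>n. ennreal ((cmod (v n x - \<phi> x))\<^sup>2)) \<longlonglongrightarrow> ennreal ((cmod (\<phi> x * complex_of_real 1 - \<phi> x))\<^sup>2)"
        unfolding v_def by (intro tendsto_ennrealI tendsto_intros tendsto_gauss_weight)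
      then show "(\<lambda>n. ennreal ((cmod (v n x - \<phi> x))\<^sup>2)) \<longlonglongrightarrow> 0" by simp
    qed
  qed measurable
  then have vl: "(\<lambda>n. L2_energy (\<lambda>x. v n x - \<phi> x)) \<longlonglongrightarrow> 0" by simp
  \<comment> \<open>max 0 (Re z) is the point of [0, \<infinity>) nearest to z, so |?d| is at most
    the distance of \<open>\<Phi>\<close> to any nonnegative function, in particular to the
    transform of \<open>v n\<close>.\<close>
  let ?d = "\<lambda>\<xi>. \<Phi> \<xi> - complex_of_real (max 0 (Re (\<Phi> \<xi>)))"
  have "L2_energy ?d \<le> 2 * L2_energy (\<lambda>\<xi>. fourier_int (u n) \<xi> - \<Phi> \<xi>)
     + 2 * (2 * L2_energy (\<lambda>x. v n x - \<phi> x) + 2 * L2_energy (\<lambda>x. u n x - \<phi> x))" for n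
  proof -
    have "L2_energy ?d \<le> L2_energy (\<lambda>\<xi>. \<Phi> \<xi> - fourier_int (v n) \<xi>)"
      unfolding L2_energy_def
    proof (intro nn_integral_mono ennreal_leI power_mono)
      fix \<xi>
      obtain r where r: "0 \<le> r" "fourier_int (v n) \<xi> = complex_of_real r" using vpos by metis
      have "\<bar>Re (\<Phi> \<xi>) - max 0 (Re (\<Phi> \<xi>))\<bar> \<le> \<bar>Re (\<Phi> \<xi>) - r\<bar>" using r(1) by (auto simp: max_def)
      then have "(Re (\<Phi> \<xi>) - max 0 (Re (\<Phi> \<xi>)))\<^sup>2 \<le> (Re (\<Phi> \<xi>) - r)\<^sup>2" by (rule abs_le_square_iff[THEN iffD1])
      then show "cmod (?d \<xi>) \<le> cmod (\<Phi> \<xi> - fourier_int (v n) \<xi>)" by (simp add: r(2) cmod_def)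
    qed auto
    also have "\<dots> = L2_energy (\<lambda>\<xi>. (fourier_int (u n) \<xi> - \<Phi> \<xi>) + (fourier_int (v n) \<xi> + (-1) * fourier_int (u n) \<xi>))"
      by (rule L2_energy_cong) (simp add: norm_minus_commute)
    also have "\<dots> \<le> 2 * L2_energy (\<lambda>\<xi>. fourier_int (u n) \<xi> - \<Phi> \<xi>) + 2 * L2_energy (\<lambda>\<xi>. fourier_int (v n) \<xi> + (-1) * fourier_int (u n) \<xi>)"
      by (rule L2_energy_add_le) measurable
    also have "(\<lambda>\<xi>. fourier_int (v n) \<xi> + (-1) * fourier_int (u n) \<xi>) = fourier_int (\<lambda>x. v n x + (-1) * u n x)"
      by (simp only: fun_eq_iff fourier_int_add[OF vi integrable_mult_right[OF ui]] fourier_int_cmult)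
        simp
    also have "L2_energy \<dots> \<le> L2_energy (\<lambda>x. v n x + (-1) * u n x)"
      by (intro L2_energy_fourier_int_le Bochner_Integration.integrable_add vi integrable_mult_right ui)
    also have "\<dots> = L2_energy (\<lambda>x. (v n x - \<phi> x) - (u n x - \<phi> x))" by simp
    also have "\<dots> \<le> 2 * L2_energy (\<lambda>x. v n x - \<phi> x) + 2 * L2_energy (\<lambda>x. u n x - \<phi> x)"
      by (rule L2_energy_diff_le) measurable
    finally show ?thesis by (simp add: add_left_mono mult_left_mono)
  qed
  moreover have "(\<lambda>n. 2 * L2_energy (\<lambda>\<xi>. fourier_int (u n) \<xi> - \<Phi> \<xi>)
     + 2 * (2 * L2_energy (\<lambda>x. v n x - \<phi> x) + 2 * L2_energy (\<lambda>x. u n x - \<phi> x))) \<longlonglongrightarrow> 2 * 0 + 2 * (2 * 0 + 2 * 0)"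
    by (intro tendsto_add ennreal_tendsto_cmult ul vl) auto
  ultimately have "L2_energy ?d \<le> 2 * 0 + 2 * (2 * 0 + 2 * 0)"
    by (intro LIMSEQ_le_const) auto
  then have "L2_energy ?d = 0" by simp
  then have "AE \<xi> in lborel. ennreal ((cmod (?d \<xi>))\<^sup>2) = 0"
    unfolding L2_energy_def by (subst (asm) nn_integral_0_iff_AE) auto
  then show ?thesis
  proof eventually_elim
    case (elim \<xi>)
    then have "\<Phi> \<xi> = complex_of_real (max 0 (Re (\<Phi> \<xi>)))" by simp
    then show ?case by (metis Re_complex_of_real max.cobounded1)
  qed
qed

subsection \<open>Approximation by trigonometric polynomials\<close>

text \<open>The family \<open>b\<close> is arbitrary because the notion serves twice: for
  trigonometric polynomials and for combinations of integer translates.\<close>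

definition int_lincomb :: "(int \<Rightarrow> real \<Rightarrow> complex) \<Rightarrow> (real \<Rightarrow> complex) \<Rightarrow> bool" where
  "int_lincomb b u \<longleftrightarrow> (\<exists>J c. finite J \<and> u = (\<lambda>x. \<Sum>j\<in>J. c j * b j x))"

lemma int_lincomb_zero: "int_lincomb b (\<lambda>x. 0)"
  unfolding int_lincomb_def by (rule exI[of _ "{}"]) auto

lemma int_lincomb_base: "int_lincomb b (b j)"
  unfolding int_lincomb_def by (rule exI[of _ "{j}"], rule exI[of _ "\<lambda>_. 1"]) auto

lemma int_lincomb_cmult:
  assumes "int_lincomb b u" shows "int_lincomb b (\<lambda>x. a * u x)"
proof -
  obtain J c where "finite J" "u = (\<lambda>x. \<Sum>j\<in>J. c j * b j x)"
    using assms unfolding int_lincomb_def by blast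
  then show ?thesis unfolding int_lincomb_def
    by (intro exI[of _ J] exI[of _ "\<lambda>j. a * c j"]) (simp add: sum_distrib_left mult.assoc)
qed

lemma int_lincomb_add:
  assumes "int_lincomb b u" "int_lincomb b v" shows "int_lincomb b (\<lambda>x. u x + v x)"
proof -
  obtain J c where J: "finite J" "u = (\<lambda>x. \<Sum>j\<in>J. c j * b j x)"
    using assms unfolding int_lincomb_def by blast
  obtain K d where K: "finite K" "v = (\<lambda>x. \<Sum>j\<in>K. d j * b j x)"
    using assms unfolding int_lincomb_def by blast
  let ?c = "\<lambda>j. if j \<in> J then c j else 0" and ?d = "\<lambda>j. if j \<in> K then d j else 0"
  have "u x + v x = (\<Sum>j\<in>J \<union> K. (?c j + ?d j) * b j x)" for x
  proof -
    have "u x = (\<Sum>j\<in>J \<union> K. ?c j * b j x)"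
      unfolding J(2) using J(1) K(1) by (intro sum.mono_neutral_cong_left) auto
    moreover have "v x = (\<Sum>j\<in>J \<union> K. ?d j * b j x)"
      unfolding K(2) using J(1) K(1) by (intro sum.mono_neutral_cong_left) auto
    ultimately show ?thesis by (simp add: distrib_right sum.distrib)
  qed
  then show ?thesis unfolding int_lincomb_def using J(1) K(1)
    by (intro exI[of _ "J \<union> K"] exI[of _ "\<lambda>j. ?c j + ?d j"]) auto
qed

lemma int_lincomb_sum:
  assumes "finite I" "\<And>i. i \<in> I \<Longrightarrow> int_lincomb b (u i)"
  shows "int_lincomb b (\<lambda>x. \<Sum>i\<in>I. u i x)"
  using assms by induction (auto intro: int_lincomb_zero int_lincomb_add)

text \<open>The sign in the exponent is chosen so that \<open>trig_char j\<close> is the factor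
  which translation by j produces in the transform.\<close>

definition trig_char :: "int \<Rightarrow> real \<Rightarrow> complex" where
  "trig_char j \<xi> = exp (- \<i> * complex_of_real (\<xi> * real_of_int j))"

lemma trig_char_add: "trig_char (j + k) x = trig_char j x * trig_char k x"
  by (simp add: trig_char_def exp_add[symmetric] algebra_simps)

lemma int_lincomb_trig_char_mult:
  assumes "int_lincomb trig_char u" "int_lincomb trig_char v"
  shows "int_lincomb trig_char (\<lambda>x. u x * v x)"
proof -
  obtain J c where J: "finite J" "u = (\<lambda>x. \<Sum>j\<in>J. c j * trig_char j x)"
    using assms unfolding int_lincomb_def by blast
  obtain K d where K: "finite K" "v = (\<lambda>x. \<Sum>j\<in>K. d j * trig_char j x)"
    using assms unfolding int_lincomb_def by blast
  have "u x * v x = (\<Sum>j\<in>J. \<Sum>k\<in>K. (c j * d k) * trig_char (j + k) x)" for x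
    by (simp add: J K sum_product trig_char_add mult_ac)
  moreover have "int_lincomb trig_char (\<lambda>x. \<Sum>j\<in>J. \<Sum>k\<in>K. (c j * d k) * trig_char (j + k) x)"
    by (intro int_lincomb_sum J K int_lincomb_cmult int_lincomb_base)
  ultimately show ?thesis by simp
qed

text \<open>A real linear functional on the plane, restricted to the unit circle, is a combination
  of cosine and sine, hence of the characters 1 and -1; products of characters are characters
  again.\<close>

lemma int_lincomb_trig_char_polynomial:
  assumes "real_polynomial_function (p :: complex \<Rightarrow> real)"
  shows "int_lincomb trig_char (\<lambda>x. complex_of_real (p (cis x)))"
  using assms
proof induction
  case (linear f)
  interpret bounded_linear f by fact
  have "cis x = cos x *\<^sub>R 1 + sin x *\<^sub>R \<i>" for x by (simp add: complex_eq_iff)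
  then have fe: "f (cis x) = cos x * f 1 + sin x * f \<i>" for x by (simp add: add scaleR)
  have cs: "complex_of_real (cos x) = (trig_char 1 x + trig_char (- 1) x) / 2"
    "complex_of_real (sin x) = (trig_char (- 1) x - trig_char 1 x) / (2 * \<i>)" for x
    by (simp_all add: trig_char_def cos_of_real[symmetric] sin_of_real[symmetric] cos_exp_eq sin_exp_eq algebra_simps)
  have "complex_of_real (f (cis x)) = (f 1 / 2 - f \<i> / (2 * \<i>)) * trig_char 1 x
      + (f 1 / 2 + f \<i> / (2 * \<i>)) * trig_char (- 1) x" for x
    by (simp only: fe of_real_add of_real_mult cs) (simp add: field_simps)
  moreover have "int_lincomb trig_char (\<lambda>x. (f 1 / 2 - f \<i> / (2 * \<i>)) * trig_char 1 x
      + (f 1 / 2 + f \<i> / (2 * \<i>)) * trig_char (- 1) x)"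
    by (intro int_lincomb_add int_lincomb_cmult int_lincomb_base)
  ultimately show ?case by simp
next
  case (const c)
  have "trig_char 0 x = 1" for x by (simp add: trig_char_def)
  then show ?case using int_lincomb_cmult[OF int_lincomb_base[of trig_char 0], of "complex_of_real c"]
    by simp
next
  case (add f g)
  then show ?case by (simp add: int_lincomb_add)
next
  case (mult f g)
  then show ?case by (simp add: int_lincomb_trig_char_mult)
qed

text \<open>Vanishing at both ends of [-pi, pi] lets \<open>g\<close> descend to a continuous
  function on the circle, where the Stone-Weierstrass theorem supplies a polynomial.\<close>

lemma trig_uniform_approximation:
  fixes g :: "real \<Rightarrow> real"
  assumes c: "continuous_on UNIV g" and z: "\<And>x. pi \<le> \<bar>x\<bar> \<Longrightarrow> g x = 0" and e: "0 < e"
  obtains u where "int_lincomb trig_char u"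
    "\<And>x. x \<in> {-pi..pi} \<Longrightarrow> cmod (complex_of_real (g x) - u x) < e"
proof -
  let ?h = "\<lambda>z. g (Arg z)"
  have h: "?h (cis x) = g x" if "x \<in> {-pi..pi}" for x
  proof (cases "x = - pi")
    case True
    then have "cis x = cis pi" by (simp add: complex_eq_iff)
    then have "Arg (cis x) = pi" by (simp only:) (rule Arg_cis, auto)
    then show ?thesis using True by (simp add: z)
  next
    case False
    then have "Arg (cis x) = x" using that by (intro Arg_cis) auto
    then show ?thesis by simp
  qed
  \<comment> \<open>\<open>Arg\<close> jumps at -1, so continuity is tested on closed sets: the
    preimage of a closed set is the image under \<open>cis\<close> of a compact part of
    [-pi, pi].\<close>
  have "continuous_on (sphere 0 1) ?h"
  proof (subst continuous_on_closed_vimage)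
    show "\<forall>B. closed B \<longrightarrow> closed (?h -` B \<inter> sphere 0 1)"
    proof (intro allI impI)
      fix B :: "real set" assume B: "closed B"
      have "?h -` B \<inter> sphere 0 1 = cis ` (g -` B \<inter> {-pi..pi})"
      proof (intro equalityI subsetI)
        fix w assume w: "w \<in> ?h -` B \<inter> sphere 0 1"
        then have w1: "cmod w = 1" by simp
        then have "w \<noteq> 0" by auto
        with w1 have "w = cis (Arg w)" using cis_Arg[of w] by (simp add: sgn_div_norm)
        moreover have "Arg w \<in> g -` B \<inter> {-pi..pi}"
          using w Arg_bounded[of w] by auto
        ultimately show "w \<in> cis ` (g -` B \<inter> {-pi..pi})" by blast
      next
        fix w assume "w \<in> cis ` (g -` B \<inter> {-pi..pi})"
        then show "w \<in> ?h -` B \<inter> sphere 0 1" using h by auto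
      qed
      moreover have "compact (g -` B \<inter> {-pi..pi})"
        using c B by (intro closed_Int_compact compact_Icc closed_vimage) auto
      then have "compact (cis ` (g -` B \<inter> {-pi..pi}))"
        by (intro compact_continuous_image continuous_intros)
      ultimately show "closed (?h -` B \<inter> sphere 0 1)" by (simp add: compact_imp_closed)
    qed
  qed simp
  then obtain p where p: "real_polynomial_function p" "\<And>z. z \<in> sphere 0 1 \<Longrightarrow> \<bar>?h z - p z\<bar> < e"
    using Stone_Weierstrass_real_polynomial_function[of "sphere 0 1" ?h e] e compact_sphere by blast
  show thesis
  proof (rule that[OF int_lincomb_trig_char_polynomial[OF p(1)]])
    fix x :: real assume "x \<in> {-pi..pi}"
    then have "\<bar>g x - p (cis x)\<bar> < e" using p(2)[of "cis x"] h by simp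
    then show "cmod (complex_of_real (g x) - complex_of_real (p (cis x))) < e"
      by (simp flip: of_real_diff)
  qed
qed

lemma int_lincomb_measurable:
  assumes "int_lincomb b u" "\<And>j. b j \<in> borel_measurable borel"
  shows "u \<in> borel_measurable borel"
proof -
  obtain J c where J: "finite J" "u = (\<lambda>x. \<Sum>j\<in>J. c j * b j x)"
    using assms unfolding int_lincomb_def by blast
  show ?thesis unfolding J(2)
    by (intro borel_measurable_sum borel_measurable_times borel_measurable_const assms)
qed

lemma trig_char_measurable [measurable]: "trig_char j \<in> borel_measurable borel"
  unfolding trig_char_def by measurable

lemma torus_measurable [measurable]: "torus \<in> sets borel"
  unfolding torus_def by simp

lemma ennreal_double_add_less:
  assumes "a < ennreal (e / 4)" "b < ennreal (e / 4)"
  shows "2 * a + 2 * b < ennreal e"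
proof -
  have e: "0 < e" using assms(1) by (cases "0 < e") (auto simp: ennreal_neg)
  obtain a' where a': "0 \<le> a'" "a = ennreal a'" using assms(1) by (cases a) auto
  obtain b' where b': "0 \<le> b'" "b = ennreal b'" using assms(2) by (cases b) auto
  have "a' < e / 4" "b' < e / 4" using assms a' b' by (simp_all add: ennreal_less_iff)
  moreover have "2 * a + 2 * b = ennreal (2 * a' + 2 * b')"
    using a' b' by (simp add: ennreal_mult)
  ultimately show ?thesis using e by (simp only:) (rule ennreal_lessI, auto)
qed

lemma trig_L2_approximation:
  fixes q :: "real \<Rightarrow> real"
  assumes q [measurable]: "q \<in> borel_measurable borel" and B: "\<And>x. \<bar>q x\<bar> \<le> B" and e: "0 < e"
  obtains u where "int_lincomb trig_char u"
    "(\<integral>\<^sup>+x\<in>torus. ennreal ((cmod (complex_of_real (q x) - u x))\<^sup>2) \<partial>lborel) < ennreal e"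
proof -
  obtain g where g: "\<And>n. continuous_on UNIV (g n)" "\<And>n x. \<bar>g n x\<bar> \<le> B" "\<And>n x. pi \<le> \<bar>x\<bar> \<Longrightarrow> g n x = 0"
    "AE x in lborel. \<bar>x\<bar> < pi \<longrightarrow> (\<lambda>n. g n x) \<longlonglongrightarrow> q x"
    by (rule bounded_measurable_limit_continuous[OF q B, where R=pi]) blast
  have gm [measurable]: "g n \<in> borel_measurable borel" for n
    using g(1) by (rule borel_measurable_continuous_onI)
  have "(\<lambda>n. \<integral>\<^sup>+x\<in>torus. ennreal ((q x - g n x)\<^sup>2) \<partial>lborel) \<longlonglongrightarrow> (\<integral>\<^sup>+(x::real). 0 \<partial>lborel)"
  proof (rule nn_integral_dominated_convergence[where w="\<lambda>x. ennreal ((2 * B)\<^sup>2) * indicator torus x"])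
    show "(\<integral>\<^sup>+ x. ennreal ((2 * B)\<^sup>2) * indicator torus x \<partial>lborel) < \<infinity>"
      by (simp add: nn_integral_cmult_indicator ennreal_mult_less_top torus_def emeasure_lborel_Ico)
    show "AE x in lborel. ennreal ((q x - g n x)\<^sup>2) * indicator torus x \<le> ennreal ((2 * B)\<^sup>2) * indicator torus x" for n
    proof (intro AE_I2 mult_right_mono ennreal_leI)
      fix x
      have "\<bar>q x - g n x\<bar> \<le> \<bar>2 * B\<bar>" using B[of x] g(2)[of n x] by linarith
      then show "(q x - g n x)\<^sup>2 \<le> (2 * B)\<^sup>2" by (rule abs_le_square_iff[THEN iffD1])
    qed auto
    \<comment> \<open>The torus contains its left endpoint, where the convergence of
      \<open>g n\<close> to \<open>q\<close> is not asserted.\<close>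
    have "AE x in lborel. x \<noteq> - pi" by (rule AE_lborel_singleton)
    with g(4) show "AE x in lborel. (\<lambda>n. ennreal ((q x - g n x)\<^sup>2) * indicator torus x) \<longlonglongrightarrow> 0"
    proof eventually_elim
      case (elim x)
      show ?case
      proof (cases "x \<in> torus")
        case True
        then have "\<bar>x\<bar> < pi" using elim by (auto simp: torus_def abs_less_iff)
        then have "(\<lambda>n. ennreal ((q x - g n x)\<^sup>2)) \<longlonglongrightarrow> ennreal ((q x - q x)\<^sup>2)"
          using elim by (intro tendsto_ennrealI tendsto_intros) auto
        then show ?thesis using True by simp
      qed simp
    qed
  qed measurable
  then have "(\<lambda>n. \<integral>\<^sup>+x\<in>torus. ennreal ((q x - g n x)\<^sup>2) \<partial>lborel) \<longlonglongrightarrow> 0" by simp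
  then have "eventually (\<lambda>n. (\<integral>\<^sup>+x\<in>torus. ennreal ((q x - g n x)\<^sup>2) \<partial>lborel) < ennreal (e / 4)) sequentially"
    using e by (intro order_tendstoD) auto
  then obtain n where n: "(\<integral>\<^sup>+x\<in>torus. ennreal ((q x - g n x)\<^sup>2) \<partial>lborel) < ennreal (e / 4)"
    using eventually_happens by force
  \<comment> \<open>A uniform error d contributes at most d^2 times the length 2 pi of the torus,
    that is e / 8, which lies below the allowance e / 4.\<close>
  define d where "d = sqrt (e / (16 * pi))"
  have d: "0 < d" "d\<^sup>2 = e / (16 * pi)" using e by (auto simp: d_def)
  obtain u where u: "int_lincomb trig_char u" "\<And>x. x \<in> {-pi..pi} \<Longrightarrow> cmod (complex_of_real (g n x) - u x) < d"
    by (rule trig_uniform_approximation[OF g(1) g(3) d(1)]) blast+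
  have [measurable]: "u \<in> borel_measurable borel" by (rule int_lincomb_measurable[OF u(1)]) measurable
  have "(\<integral>\<^sup>+x\<in>torus. ennreal ((cmod (complex_of_real (g n x) - u x))\<^sup>2) \<partial>lborel) \<le> (\<integral>\<^sup>+x. ennreal (d\<^sup>2) * indicator torus x \<partial>lborel)"
  proof (intro nn_integral_mono)
    fix x
    show "ennreal ((cmod (complex_of_real (g n x) - u x))\<^sup>2) * indicator torus x \<le> ennreal (d\<^sup>2) * indicator torus x"
      using power_mono[OF less_imp_le[OF u(2)[of x]], of 2]
      by (auto simp: torus_def indicator_def intro!: ennreal_leI)
  qed
  also have "\<dots> = ennreal (d\<^sup>2) * ennreal (2 * pi)"
    by (simp add: nn_integral_cmult_indicator torus_def)
  also have "\<dots> = ennreal (e / 8)" using e by (simp add: d(2) flip: ennreal_mult)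
  also have "\<dots> < ennreal (e / 4)" using e by (simp add: ennreal_less_iff)
  finally have 2: "(\<integral>\<^sup>+x\<in>torus. ennreal ((cmod (complex_of_real (g n x) - u x))\<^sup>2) \<partial>lborel) < ennreal (e / 4)" .
  have "(\<integral>\<^sup>+x\<in>torus. ennreal ((cmod (complex_of_real (q x) - u x))\<^sup>2) \<partial>lborel)
     = L2_energy (\<lambda>x. indicator torus x * (complex_of_real (q x) - complex_of_real (g n x)) + indicator torus x * (complex_of_real (g n x) - u x))"
    unfolding L2_energy_def by (intro nn_integral_cong) (auto simp: indicator_def)
  also have "\<dots> \<le> 2 * L2_energy (\<lambda>x. indicator torus x * (complex_of_real (q x) - complex_of_real (g n x))) + 2 * L2_energy (\<lambda>x. indicator torus x * (complex_of_real (g n x) - u x))"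
    by (rule L2_energy_add_le) measurable
  also have "L2_energy (\<lambda>x. indicator torus x * (complex_of_real (q x) - complex_of_real (g n x))) = (\<integral>\<^sup>+x\<in>torus. ennreal ((q x - g n x)\<^sup>2) \<partial>lborel)"
    unfolding L2_energy_def by (intro nn_integral_cong) (auto simp: indicator_def simp flip: of_real_diff)
  also have "L2_energy (\<lambda>x. indicator torus x * (complex_of_real (g n x) - u x)) = (\<integral>\<^sup>+x\<in>torus. ennreal ((cmod (complex_of_real (g n x) - u x))\<^sup>2) \<partial>lborel)"
    unfolding L2_energy_def by (intro nn_integral_cong) (auto simp: indicator_def)
  also have "2 * (\<integral>\<^sup>+x\<in>torus. ennreal ((q x - g n x)\<^sup>2) \<partial>lborel) + 2 * \<dots> < ennreal e"
    by (rule ennreal_double_add_less[OF n 2])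
  finally show thesis by (rule that[OF u(1)])
qed

subsection \<open>Closed spans of integer translates\<close>

text \<open>Membership in the closed span of translates, measured by energies and without square
  integrability of \<open>u\<close>. This suits the chain of squared triangle inequalities;
  \<open>V_int\<close> is recovered by restricting to square integrable functions.\<close>

definition shift_closure :: "(real \<Rightarrow> complex) \<Rightarrow> (real \<Rightarrow> complex) \<Rightarrow> bool" where
  "shift_closure f u \<longleftrightarrow> u \<in> borel_measurable borel \<and>
     (\<forall>e>0. \<exists>v. int_lincomb (\<lambda>j x. f (x - real_of_int j)) v \<and> L2_energy (\<lambda>x. u x - v x) < ennreal e)"

lemma shift_measurable:
  assumes [measurable]: "f \<in> borel_measurable borel"
  shows "(\<lambda>x. f (x - t :: real)) \<in> borel_measurable (borel :: real measure)"
  by measurable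

lemma shift_lincomb_measurable:
  assumes "f \<in> borel_measurable borel" "int_lincomb (\<lambda>j x. f (x - real_of_int j)) v"
  shows "v \<in> borel_measurable borel"
  by (rule int_lincomb_measurable[OF assms(2)]) (rule shift_measurable[OF assms(1)])

lemma L2_energy_shift_lincomb_finite:
  assumes f: "f \<in> borel_measurable borel" "L2_energy f < \<infinity>" and v: "int_lincomb (\<lambda>j x. f (x - real_of_int j)) v"
  shows "L2_energy v < \<infinity>"
proof -
  note [measurable] = f(1)
  obtain J c where J: "finite J" "v = (\<lambda>x. \<Sum>j\<in>J. c j * f (x - real_of_int j))"
    using v unfolding int_lincomb_def by blast
  from J(1) have "L2_energy (\<lambda>x. \<Sum>j\<in>J. c j * f (x - real_of_int j)) < \<infinity>"
  proof induction
    case empty show ?case by (simp add: L2_energy_def)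
  next
    case (insert j J)
    have "L2_energy (\<lambda>x. c j * f (x - real_of_int j) + (\<Sum>j\<in>J. c j * f (x - real_of_int j)))
      \<le> 2 * L2_energy (\<lambda>x. c j * f (x - real_of_int j)) + 2 * L2_energy (\<lambda>x. \<Sum>j\<in>J. c j * f (x - real_of_int j))"
      by (rule L2_energy_add_le) measurable
    also have "\<dots> < \<infinity>"
      using insert.IH f(2) by (simp add: L2_energy_cmult L2_energy_shift ennreal_mult_less_top)
    finally show ?case using insert.hyps by simp
  qed
  then show ?thesis by (simp add: J)
qed

text \<open>\<open>l2_dist\<close> is the root of a Bochner integral, which is faithful only when
  the difference is square integrable. Square integrability of \<open>f\<close> passes to all finite
  combinations of its translates, so there the energy is the squared distance.\<close>

lemma mem_V_int_iff:
  assumes "sq_int f"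
  shows "h \<in> V_int f \<longleftrightarrow> sq_int h \<and> shift_closure f h"
proof -
  have f: "f \<in> borel_measurable borel" "L2_energy f < \<infinity>" using assms by (auto simp: sq_int_iff)
  have eq: "L2_energy (\<lambda>x. h x - v x) = ennreal ((l2_dist h v)\<^sup>2)" if "sq_int h" "int_lincomb (\<lambda>j x. f (x - real_of_int j)) v" for v
    using that shift_lincomb_measurable[OF f(1)] L2_energy_shift_lincomb_finite[OF f]
    by (intro L2_energy_diff_eq_l2_dist) (auto simp: sq_int_iff)
  have V: "h \<in> V_int f \<longleftrightarrow> sq_int h \<and> (\<forall>e>0. \<exists>v. int_lincomb (\<lambda>j x. f (x - real_of_int j)) v \<and> l2_dist h v < e)"
    unfolding V_int_def int_lincomb_def by blast
  have nn: "0 \<le> l2_dist h v" for v by (simp add: l2_dist_def integral_nonneg_AE)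
  show ?thesis
  proof (cases "sq_int h")
    case True
    have "(\<forall>e>0. \<exists>v. int_lincomb (\<lambda>j x. f (x - real_of_int j)) v \<and> l2_dist h v < e) \<longleftrightarrow>
      (\<forall>e>0. \<exists>v. int_lincomb (\<lambda>j x. f (x - real_of_int j)) v \<and> L2_energy (\<lambda>x. h x - v x) < ennreal e)" (is "?A \<longleftrightarrow> ?B")
    proof (intro iffI allI impI)
      fix e :: real assume A: ?A and e: "0 < e"
      then obtain v where v: "int_lincomb (\<lambda>j x. f (x - real_of_int j)) v" "l2_dist h v < sqrt e"
        using real_sqrt_gt_zero by blast
      then have "(l2_dist h v)\<^sup>2 < (sqrt e)\<^sup>2" using nn by (intro power_strict_mono) auto
      then show "\<exists>v. int_lincomb (\<lambda>j x. f (x - real_of_int j)) v \<and> L2_energy (\<lambda>x. h x - v x) < ennreal e"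
        using v e eq[OF True v(1)] by (intro exI[of _ v]) (simp add: ennreal_less_iff)
    next
      fix e :: real assume B: ?B and e: "0 < e"
      then obtain v where v: "int_lincomb (\<lambda>j x. f (x - real_of_int j)) v" "L2_energy (\<lambda>x. h x - v x) < ennreal (e\<^sup>2)"
        by (meson zero_less_power)
      then have "(l2_dist h v)\<^sup>2 < e\<^sup>2" using eq[OF True v(1)] by (simp add: ennreal_less_iff)
      then have "l2_dist h v < e" by (rule power2_less_imp_less) (use e in simp)
      then show "\<exists>v. int_lincomb (\<lambda>j x. f (x - real_of_int j)) v \<and> l2_dist h v < e" using v by blast
    qed
    then show ?thesis using True V by (simp add: shift_closure_def sq_int_iff)
  qed (simp add: V)
qed

lemma shift_lincomb_shift:
  assumes "int_lincomb (\<lambda>j x. f (x - real_of_int j)) v"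
  shows "int_lincomb (\<lambda>j x. f (x - real_of_int j)) (\<lambda>x. v (x - real_of_int k))"
proof -
  obtain J c where J: "finite J" "v = (\<lambda>x. \<Sum>j\<in>J. c j * f (x - real_of_int j))"
    using assms unfolding int_lincomb_def by blast
  have "int_lincomb (\<lambda>j x. f (x - real_of_int j)) (\<lambda>x. \<Sum>j\<in>J. c j * (\<lambda>j x. f (x - real_of_int j)) (j + k) x)"
    by (intro int_lincomb_sum J int_lincomb_cmult int_lincomb_base)
  then show ?thesis by (simp add: J algebra_simps)
qed

lemma shift_closure_add:
  assumes f [measurable]: "f \<in> borel_measurable borel" and "shift_closure f u" "shift_closure f w"
  shows "shift_closure f (\<lambda>x. u x + w x)"
  unfolding shift_closure_def
proof (intro conjI allI impI)
  have [measurable]: "u \<in> borel_measurable borel" "w \<in> borel_measurable borel"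
    using assms by (auto simp: shift_closure_def)
  show "(\<lambda>x. u x + w x) \<in> borel_measurable borel" by measurable
  fix e :: real assume "0 < e"
  then have "0 < e / 4" by simp
  then obtain v v' where v: "int_lincomb (\<lambda>j x. f (x - real_of_int j)) v" "L2_energy (\<lambda>x. u x - v x) < ennreal (e / 4)"
    and v': "int_lincomb (\<lambda>j x. f (x - real_of_int j)) v'" "L2_energy (\<lambda>x. w x - v' x) < ennreal (e / 4)"
    using assms(2,3) unfolding shift_closure_def by meson
  note [measurable] = shift_lincomb_measurable[OF f v(1)] shift_lincomb_measurable[OF f v'(1)]
  have "L2_energy (\<lambda>x. (u x + w x) - (v x + v' x)) = L2_energy (\<lambda>x. (u x - v x) + (w x - v' x))"
    by (rule L2_energy_cong) (simp add: algebra_simps)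
  also have "\<dots> \<le> 2 * L2_energy (\<lambda>x. u x - v x) + 2 * L2_energy (\<lambda>x. w x - v' x)"
    by (rule L2_energy_add_le) measurable
  also have "\<dots> < ennreal e" by (rule ennreal_double_add_less[OF v(2) v'(2)])
  finally show "\<exists>v. int_lincomb (\<lambda>j x. f (x - real_of_int j)) v \<and> L2_energy (\<lambda>x. u x + w x - v x) < ennreal e"
    using int_lincomb_add[OF v(1) v'(1)] by blast
qed

lemma shift_closure_cmult_shift:
  assumes f [measurable]: "f \<in> borel_measurable borel" and u: "shift_closure f u"
  shows "shift_closure f (\<lambda>x. c * u (x - real_of_int k))"
  unfolding shift_closure_def
proof (intro conjI allI impI)
  have [measurable]: "u \<in> borel_measurable borel" using u by (auto simp: shift_closure_def)
  show "(\<lambda>x. c * u (x - real_of_int k)) \<in> borel_measurable borel" by measurable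
  fix e :: real assume e: "0 < e"
  \<comment> \<open>The summand 1 keeps the denominator positive for c = 0 and makes the final
    inequality strict.\<close>
  let ?d = "e / ((cmod c)\<^sup>2 + 1)"
  have p: "0 < (cmod c)\<^sup>2 + 1" by (simp add: add_nonneg_pos)
  then have "0 < ?d" using e by simp
  then obtain v where v: "int_lincomb (\<lambda>j x. f (x - real_of_int j)) v" "L2_energy (\<lambda>x. u x - v x) < ennreal ?d"
    using u unfolding shift_closure_def by meson
  note [measurable] = shift_lincomb_measurable[OF f v(1)]
  have "L2_energy (\<lambda>x. c * u (x - real_of_int k) - c * v (x - real_of_int k)) = ennreal ((cmod c)\<^sup>2) * L2_energy (\<lambda>x. u x - v x)"
    by (simp add: right_diff_distrib[symmetric] L2_energy_cmult L2_energy_shift[where f="\<lambda>x. u x - v x"])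
  also have "\<dots> \<le> ennreal ((cmod c)\<^sup>2) * ennreal ?d" using v(2) by (intro mult_left_mono) auto
  also have "\<dots> = ennreal ((cmod c)\<^sup>2 * ?d)" using e p by (intro ennreal_mult[symmetric]) auto
  also have "\<dots> < ennreal e"
    using e p by (intro ennreal_lessI) (auto simp: field_simps)
  finally show "\<exists>v. int_lincomb (\<lambda>j x. f (x - real_of_int j)) v \<and> L2_energy (\<lambda>x. c * u (x - real_of_int k) - v x) < ennreal e"
    using int_lincomb_cmult[OF shift_lincomb_shift[OF v(1)], of c k] by blast
qed

lemma shift_closure_zero: "shift_closure f (\<lambda>x. 0)"
  unfolding shift_closure_def using int_lincomb_zero by (auto simp: L2_energy_def intro!: exI[of _ "\<lambda>x. 0"])

text \<open>A closed span is closed under its own operations: \<open>h\<close> is near a combination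
  of translates of \<open>g\<close>, and that combination lies in the closure for \<open>f\<close>,
  which is stable under integer translation, scaling and addition.\<close>

lemma shift_closure_trans:
  assumes f [measurable]: "f \<in> borel_measurable borel" and g: "shift_closure f g" and h: "shift_closure g h"
  shows "shift_closure f h"
  unfolding shift_closure_def
proof (intro conjI allI impI)
  show [measurable]: "h \<in> borel_measurable borel" using h by (auto simp: shift_closure_def)
  have gm: "g \<in> borel_measurable borel" using g by (auto simp: shift_closure_def)
  fix e :: real assume "0 < e"
  then have e4: "0 < e / 4" by simp
  then obtain u where u: "int_lincomb (\<lambda>j x. g (x - real_of_int j)) u" "L2_energy (\<lambda>x. h x - u x) < ennreal (e / 4)"
    using h unfolding shift_closure_def by meson
  then obtain J c where J: "finite J" "u = (\<lambda>x. \<Sum>j\<in>J. c j * g (x - real_of_int j))"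
    unfolding int_lincomb_def by blast
  have "shift_closure f u"
    unfolding J(2) using J(1)
  proof induction
    case (insert j J)
    then show ?case
      using shift_closure_add[OF f shift_closure_cmult_shift[OF f g, of "c j" j]] by simp
  qed (simp add: shift_closure_zero)
  then obtain v where v: "int_lincomb (\<lambda>j x. f (x - real_of_int j)) v" "L2_energy (\<lambda>x. u x - v x) < ennreal (e / 4)"
    using e4 unfolding shift_closure_def by meson
  note [measurable] = shift_lincomb_measurable[OF f v(1)] shift_lincomb_measurable[OF gm u(1)]
  have "L2_energy (\<lambda>x. h x - v x) = L2_energy (\<lambda>x. (h x - u x) + (u x - v x))"
    by (rule L2_energy_cong) simp
  also have "\<dots> \<le> 2 * L2_energy (\<lambda>x. h x - u x) + 2 * L2_energy (\<lambda>x. u x - v x)"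
    by (rule L2_energy_add_le) measurable
  also have "\<dots> < ennreal e" by (rule ennreal_double_add_less[OF u(2) v(2)])
  finally show "\<exists>v. int_lincomb (\<lambda>j x. f (x - real_of_int j)) v \<and> L2_energy (\<lambda>x. h x - v x) < ennreal e"
    using v(1) by blast
qed

lemma V_int_eqI:
  assumes "sq_int f" "sq_int g" "shift_closure f g" "shift_closure g f"
  shows "V_int f = V_int g"
proof (rule set_eqI)
  fix h
  have "f \<in> borel_measurable borel" "g \<in> borel_measurable borel"
    using assms(1,2) by (auto simp: sq_int_iff)
  then have "shift_closure f h \<longleftrightarrow> shift_closure g h"
    using shift_closure_trans[of f g h] shift_closure_trans[of g f h] assms(3,4) by metis
  then show "h \<in> V_int f \<longleftrightarrow> h \<in> V_int g"
    using assms(1,2) by (simp only: mem_V_int_iff)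
qed

subsection \<open>Periodization\<close>

text \<open>The index is the floor of (x + pi) / (2 pi). Coding integers by naturals allows the
  translates to be summed as a series.\<close>

lemma ex_int_decode_translate_torus: "\<exists>n. x - 2 * pi * real_of_int (int_decode n) \<in> torus"
proof -
  define k where "k = \<lfloor>(x + pi) / (2 * pi)\<rfloor>"
  have "real_of_int k \<le> (x + pi) / (2 * pi)" "(x + pi) / (2 * pi) < real_of_int k + 1"
    unfolding k_def by linarith+
  then have "x - 2 * pi * real_of_int k \<in> torus"
    using pi_gt_zero by (auto simp: torus_def field_simps)
  then have "x - 2 * pi * real_of_int (int_decode (int_encode k)) \<in> torus" by simp
  then show ?thesis by blast
qed

text \<open>Translates of the torus cover the line, so the integral of \<open>H\<close> is at most
  the sum of its integrals over them; each piece is shifted back to the torus, where the assumed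
  bound applies.\<close>

lemma nn_integral_periodization_le:
  fixes H G :: "real \<Rightarrow> ennreal"
  assumes [measurable]: "H \<in> borel_measurable borel" "G \<in> borel_measurable borel"
    and le: "AE \<xi> in lborel. \<xi> \<in> torus \<longrightarrow> (\<forall>j. H (\<xi> + 2 * pi * real_of_int j) \<le> ennreal (a j) * G \<xi>)"
  shows "(\<integral>\<^sup>+\<xi>. H \<xi> \<partial>lborel) \<le> (\<Sum>n. ennreal (a (int_decode n))) * (\<integral>\<^sup>+\<xi>\<in>torus. G \<xi> \<partial>lborel)"
proof -
  let ?t = "\<lambda>n. 2 * pi * real_of_int (int_decode n)"
  have "(\<integral>\<^sup>+\<xi>. H \<xi> \<partial>lborel) \<le> (\<integral>\<^sup>+\<xi>. (\<Sum>n. H \<xi> * indicator torus (\<xi> - ?t n)) \<partial>lborel)"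
  proof (rule nn_integral_mono)
    fix \<xi>
    obtain n where n: "\<xi> - ?t n \<in> torus" using ex_int_decode_translate_torus by blast
    have "(\<Sum>m\<in>{n}. H \<xi> * indicator torus (\<xi> - ?t m)) \<le> (\<Sum>n. H \<xi> * indicator torus (\<xi> - ?t n))"
      by (rule sum_le_suminf) auto
    then show "H \<xi> \<le> (\<Sum>n. H \<xi> * indicator torus (\<xi> - ?t n))" using n by simp
  qed
  also have "\<dots> = (\<Sum>n. \<integral>\<^sup>+\<xi>. H \<xi> * indicator torus (\<xi> - ?t n) \<partial>lborel)"
    by (rule nn_integral_suminf) measurable
  also have "\<dots> \<le> (\<Sum>n. ennreal (a (int_decode n)) * (\<integral>\<^sup>+\<xi>\<in>torus. G \<xi> \<partial>lborel))"
  proof (rule suminf_le)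
    fix n
    have "(\<integral>\<^sup>+\<xi>. H \<xi> * indicator torus (\<xi> - ?t n) \<partial>lborel) = (\<integral>\<^sup>+\<xi>. H (\<xi> + ?t n) * indicator torus \<xi> \<partial>lborel)"
      by (subst nn_integral_real_affine[where c=1 and t="?t n"]) (auto simp: add.commute)
    also have "\<dots> \<le> (\<integral>\<^sup>+\<xi>. ennreal (a (int_decode n)) * (G \<xi> * indicator torus \<xi>) \<partial>lborel)"
      using le by (intro nn_integral_mono_AE) (auto simp: indicator_def elim!: eventually_mono)
    also have "\<dots> = ennreal (a (int_decode n)) * (\<integral>\<^sup>+\<xi>\<in>torus. G \<xi> \<partial>lborel)"
      by (rule nn_integral_cmult) measurable
    finally show "(\<integral>\<^sup>+\<xi>. H \<xi> * indicator torus (\<xi> - ?t n) \<partial>lborel) \<le> \<dots>" .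
  qed auto
  also have "\<dots> = (\<Sum>n. ennreal (a (int_decode n))) * (\<integral>\<^sup>+\<xi>\<in>torus. G \<xi> \<partial>lborel)"
    by (simp add: ennreal_suminf_multc)
  finally show ?thesis .
qed

lemma trig_char_periodic: "trig_char j (x + 2 * pi * real_of_int k) = trig_char j x"
proof -
  have "exp (- \<i> * complex_of_real (2 * pi * real_of_int k * real_of_int j)) = 1"
    using exp_integer_2pi[of "real_of_int (- k * j)"] by (simp add: mult_ac)
  moreover have "trig_char j (x + 2 * pi * real_of_int k) = trig_char j x *
      exp (- \<i> * complex_of_real (2 * pi * real_of_int k * real_of_int j))"
    unfolding trig_char_def exp_add[symmetric] by (rule arg_cong[where f=exp]) (simp add: algebra_simps)
  ultimately show ?thesis by simp
qed

text \<open>Summable terms eventually have modulus below 1, where the square is at most the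
  modulus.\<close>

lemma summable_square_int_decode:
  fixes b :: "int \<Rightarrow> real"
  assumes "b summable_on UNIV"
  shows "summable (\<lambda>n. (b (int_decode n))\<^sup>2)"
proof -
  have "(\<lambda>n. b (int_decode n)) summable_on UNIV"
    using assms summable_on_reindex_bij_betw[OF bij_int_decode, of b] by simp
  then have s: "summable (\<lambda>n. \<bar>b (int_decode n)\<bar>)"
    using summable_on_iff_abs_summable_on_real[of "\<lambda>n. b (int_decode n)" UNIV] by (auto intro: summable_on_imp_summable)
  then have "(\<lambda>n. \<bar>b (int_decode n)\<bar>) \<longlonglongrightarrow> 0" by (rule summable_LIMSEQ_zero)
  then have "eventually (\<lambda>n. \<bar>b (int_decode n)\<bar> < 1) sequentially" by (intro order_tendstoD) auto
  then have "eventually (\<lambda>n. norm ((b (int_decode n))\<^sup>2) \<le> \<bar>b (int_decode n)\<bar>) sequentially"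
  proof eventually_elim
    case (elim n)
    then show ?case using mult_left_le[of "\<bar>b (int_decode n)\<bar>" "\<bar>b (int_decode n)\<bar>"] by (simp add: power2_eq_square abs_mult)
  qed
  then show ?thesis using s by (rule summable_comparison_test_ev)
qed

text \<open>The bound in \<open>le\<close> says that \<open>F - p G\<close> is controlled on \<open>\<real>\<close> by \<open>q - p\<close> on the torus, for every
  periodic \<open>p\<close>; it remains to choose for \<open>p\<close> a trigonometric polynomial close to \<open>q\<close>.\<close>
lemma shift_closure_of_fourier_multiplier:
  fixes q :: "real \<Rightarrow> real"
  assumes f: "fourier_pair f F" and g: "fourier_pair g G"
    and q [measurable]: "q \<in> borel_measurable borel" and qB: "\<And>x. \<bar>q x\<bar> \<le> B"
    and b: "b summable_on UNIV" and D: "0 \<le> D"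
    and le: "AE \<xi> in lborel. \<xi> \<in> torus \<longrightarrow> (\<forall>j z. cmod (F (\<xi> + 2 * pi * real_of_int j) - z * G (\<xi> + 2 * pi * real_of_int j))
        \<le> D * b j * cmod (complex_of_real (q \<xi>) - z))"
  shows "shift_closure g f"
  unfolding shift_closure_def
proof (intro conjI allI impI)
  have fm [measurable]: "f \<in> borel_measurable borel" "F \<in> borel_measurable borel" "g \<in> borel_measurable borel" "G \<in> borel_measurable borel"
    using f g by (auto simp: fourier_pair_def)
  show "f \<in> borel_measurable borel" by fact
  fix e :: real assume e: "0 < e"
  let ?S = "\<Sum>n. (D * b (int_decode n))\<^sup>2"
  have Sm: "summable (\<lambda>n. (D * b (int_decode n))\<^sup>2)"
    unfolding power_mult_distrib by (intro summable_mult summable_square_int_decode b)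
  then have S: "0 \<le> ?S" by (intro suminf_nonneg) auto
  \<comment> \<open>The 4 cancels the constant of the energy inequality for Fourier pairs and
    \<open>?S\<close> is the square sum of the local bounds; adding 1 keeps the denominator positive
    and the last estimate strict.\<close>
  define d where "d = e / (4 * (?S + 1))"
  have d: "0 < d" using e S by (simp add: d_def)
  obtain u where u: "int_lincomb trig_char u"
    "(\<integral>\<^sup>+x\<in>torus. ennreal ((cmod (complex_of_real (q x) - u x))\<^sup>2) \<partial>lborel) < ennreal d"
    by (rule trig_L2_approximation[OF q qB d]) blast
  have [measurable]: "u \<in> borel_measurable borel" by (rule int_lincomb_measurable[OF u(1)]) measurable
  obtain J c where J: "finite J" "u = (\<lambda>x. \<Sum>j\<in>J. c j * trig_char j x)"
    using u(1) unfolding int_lincomb_def by blast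
  let ?v = "\<lambda>x. \<Sum>j\<in>J. c j * g (x - real_of_int j)"
  \<comment> \<open>By periodicity one number \<open>u \<xi>\<close> serves on all translates of
    \<xi>; it is substituted for z in the hypothesis \<open>le\<close>, whose null set does not
    depend on z.\<close>
  have uper: "u (\<xi> + 2 * pi * real_of_int j) = u \<xi>" for \<xi> j
    by (simp add: J(2) trig_char_periodic)
  have "fourier_pair ?v (\<lambda>\<xi>. u \<xi> * G \<xi>)"
    using fourier_pair_sum[OF J(1) g, of c] by (simp add: J(2) trig_char_def)
  from fourier_pair_add[OF f fourier_pair_cmult_shift[OF this, of "-1" 0]]
  have "fourier_pair (\<lambda>x. f x - ?v x) (\<lambda>\<xi>. F \<xi> - u \<xi> * G \<xi>)" by simp
  then have "L2_energy (\<lambda>x. f x - ?v x) \<le> 4 * L2_energy (\<lambda>\<xi>. F \<xi> - u \<xi> * G \<xi>)"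
    by (rule L2_energy_fourier_pair_le)
  also have "L2_energy (\<lambda>\<xi>. F \<xi> - u \<xi> * G \<xi>)
     \<le> (\<Sum>n. ennreal ((D * b (int_decode n))\<^sup>2)) * (\<integral>\<^sup>+\<xi>\<in>torus. ennreal ((cmod (complex_of_real (q \<xi>) - u \<xi>))\<^sup>2) \<partial>lborel)"
    unfolding L2_energy_def
  proof (rule nn_integral_periodization_le[where a="\<lambda>j. (D * b j)\<^sup>2"])
    show "AE \<xi> in lborel. \<xi> \<in> torus \<longrightarrow> (\<forall>j. ennreal ((cmod (F (\<xi> + 2 * pi * real_of_int j) - u (\<xi> + 2 * pi * real_of_int j) * G (\<xi> + 2 * pi * real_of_int j)))\<^sup>2)
        \<le> ennreal ((D * b j)\<^sup>2) * ennreal ((cmod (complex_of_real (q \<xi>) - u \<xi>))\<^sup>2))"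
      using le
    proof eventually_elim
      case (elim \<xi>)
      show ?case
      proof (intro impI allI)
        fix j assume "\<xi> \<in> torus"
        then have "cmod (F (\<xi> + 2 * pi * real_of_int j) - u \<xi> * G (\<xi> + 2 * pi * real_of_int j))
          \<le> D * b j * cmod (complex_of_real (q \<xi>) - u \<xi>)" using elim by blast
        then have "(cmod (F (\<xi> + 2 * pi * real_of_int j) - u \<xi> * G (\<xi> + 2 * pi * real_of_int j)))\<^sup>2
          \<le> (D * b j)\<^sup>2 * (cmod (complex_of_real (q \<xi>) - u \<xi>))\<^sup>2"
          unfolding power_mult_distrib[symmetric] by (intro power_mono) auto
        then show "ennreal ((cmod (F (\<xi> + 2 * pi * real_of_int j) - u (\<xi> + 2 * pi * real_of_int j) * G (\<xi> + 2 * pi * real_of_int j)))\<^sup>2)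
          \<le> ennreal ((D * b j)\<^sup>2) * ennreal ((cmod (complex_of_real (q \<xi>) - u \<xi>))\<^sup>2)"
          by (simp only: uper ennreal_mult[symmetric] zero_le_power2 ennreal_leI)
      qed
    qed
  qed measurable
  also have "(\<Sum>n. ennreal ((D * b (int_decode n))\<^sup>2)) = ennreal ?S"
    using Sm by (intro suminf_ennreal2) auto
  also have "4 * (ennreal ?S * (\<integral>\<^sup>+\<xi>\<in>torus. ennreal ((cmod (complex_of_real (q \<xi>) - u \<xi>))\<^sup>2) \<partial>lborel))
     \<le> 4 * (ennreal ?S * ennreal d)"
    using u(2) by (intro mult_left_mono) auto
  also have "\<dots> = ennreal (4 * (?S * d))"
    using S d by (simp add: ennreal_mult mult_nonneg_nonneg)
  also have "\<dots> < ennreal e"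
    using e S by (intro ennreal_lessI) (auto simp: d_def field_simps)
  finally have "L2_energy (\<lambda>x. f x - ?v x) < ennreal e" by (simp add: mult_left_mono)
  moreover have "int_lincomb (\<lambda>j x. g (x - real_of_int j)) ?v"
    unfolding int_lincomb_def using J(1) by blast
  ultimately show "\<exists>v. int_lincomb (\<lambda>j x. g (x - real_of_int j)) v \<and> L2_energy (\<lambda>x. f x - v x) < ennreal e"
    by blast
qed

section \<open>Local suprema, null sets and periodic sums under translation by multiples of 2
  pi\<close>

text \<open>Finiteness matters because \<open>real_of_ereal\<close> sends \<infinity> to 0. The
  value -\<infinity> cannot interfere, since it bounds no real number from above.\<close>

lemma AE_le_loc_sup:
  assumes "loc_sup g j < \<infinity>"
  shows "AE \<xi> in lborel. \<xi> \<in> torus \<longrightarrow> cmod (g (\<xi> + 2 * pi * real_of_int j)) \<le> real_of_ereal (loc_sup g j)"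
proof -
  have "AE \<xi> in restrict_space lborel torus. ereal (cmod (g (\<xi> + 2 * pi * real_of_int j))) \<le> loc_sup g j"
    unfolding loc_sup_def by (rule esssup_AE)
  then have "AE \<xi> in lborel. \<xi> \<in> torus \<longrightarrow> ereal (cmod (g (\<xi> + 2 * pi * real_of_int j))) \<le> loc_sup g j"
    by (subst (asm) AE_restrict_space_iff) simp_all
  then show ?thesis
  proof eventually_elim
    case (elim \<xi>) then show ?case using assms by (cases "loc_sup g j") auto
  qed
qed

text \<open>Countably many translates of a null set have a null union.\<close>

lemma AE_lborel_translates:
  fixes P :: "real \<Rightarrow> bool"
  assumes "Measurable.pred borel P" "AE x in lborel. P x"
  shows "AE x in lborel. \<forall>j. P (x + 2 * pi * real_of_int j)"
proof (subst AE_all_countable, rule allI)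
  fix j :: int
  show "AE x in lborel. P (x + 2 * pi * real_of_int j)"
    using AE_borel_affine[OF _ assms, of 1 "2 * pi * real_of_int j"] by (simp add: add.commute)
qed

lemma infsum_translates_periodic:
  "(\<Sum>\<^sub>\<infinity>j\<in>(UNIV::int set). \<Phi> (\<xi> + 2 * pi * real_of_int k + 2 * pi * real_of_int j))
    = (\<Sum>\<^sub>\<infinity>j\<in>(UNIV::int set). (\<Phi> (\<xi> + 2 * pi * real_of_int j) :: complex))"
proof -
  have "bij (\<lambda>j::int. k + j)" by (rule bij_plus)
  from infsum_reindex_bij_betw[OF this, of "\<lambda>j. \<Phi> (\<xi> + 2 * pi * real_of_int j)"]
  show ?thesis by (simp add: algebra_simps)
qed

theorem theorem6:
  fixes \<phi> \<Phi> L :: "real \<Rightarrow> complex"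
  assumes A1_L2: "sq_int \<phi>"
      and A1_pd: "pos_def_fun \<phi>"
      and phi_hat: "l2_fourier \<phi> \<Phi>"
      and A2_W: "in_W \<Phi>"
      and A2_inf: "ess_inf_pos \<Phi>"
      and A2_ratio: "(\<lambda>j. real_of_ereal (loc_sup \<Phi> j)) summable_on (UNIV - {0::int})"
      and L_def: "l2_fourier L (\<lambda>\<xi>. complex_of_real (1 / sqrt (2 * pi)) * \<Phi> \<xi> /
                     (\<Sum>\<^sub>\<infinity>j\<in>(UNIV::int set). \<Phi> (\<xi> + 2 * pi * real_of_int j)))"
  shows "V_int \<phi> = V_int L"
proof -
  let ?t = "\<lambda>j. 2 * pi * real_of_int j"
  let ?P = "\<lambda>\<xi>. \<Sum>\<^sub>\<infinity>j\<in>(UNIV::int set). \<Phi> (\<xi> + ?t j)"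
  let ?M = "\<lambda>\<xi>. complex_of_real (1 / sqrt (2 * pi)) * \<Phi> \<xi> / ?P \<xi>"
  define a where "a = (\<lambda>j. real_of_ereal (loc_sup \<Phi> j))"
  have fp: "fourier_pair \<phi> \<Phi>" "fourier_pair L ?M"
    using phi_hat L_def by (auto intro: fourier_pair_l2_fourier)
  have m [measurable]: "\<Phi> \<in> borel_measurable borel" using phi_hat by (simp add: l2_fourier_def sq_int_iff)
  have asum: "a summable_on UNIV" and afin: "loc_sup \<Phi> j < \<infinity>" for j
    using A2_W by (auto simp: in_W_def a_def)
  obtain c where c: "0 < c" "AE \<xi> in lborel. \<xi> \<in> torus \<longrightarrow> c \<le> cmod (\<Phi> \<xi>)"
    using A2_inf by (auto simp: ess_inf_pos_def)
  define A where "A = infsum a UNIV"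
  \<comment> \<open>A measurable real version of the periodization: a series over the naturals,
    clamped so that c \<le> Q \<le> max c A holds everywhere and not only almost everywhere. Almost
    everywhere on the torus the clamping changes nothing.\<close>
  define Q where "Q = (\<lambda>\<xi>. max c (min A (Re (\<Sum>n. \<Phi> (\<xi> + ?t (int_decode n))))))"
  define s where "s = sqrt (2 * pi)"
  have s: "0 < s" by (simp add: s_def)
  have Qm [measurable]: "Q \<in> borel_measurable borel" unfolding Q_def by measurable
  have Qc: "c \<le> Q \<xi>" and QB: "Q \<xi> \<le> max c A" and Q0: "0 < Q \<xi>" for \<xi>
    using c(1) by (auto simp: Q_def)
  have "AE \<xi> in lborel. \<forall>j. \<Phi> (\<xi> + ?t j) = complex_of_real (Re (\<Phi> (\<xi> + ?t j))) \<and> 0 \<le> Re (\<Phi> (\<xi> + ?t j))"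
    by (rule AE_lborel_translates[OF _ fourier_pair_pos_def_fun_nonneg[OF A1_pd A1_L2 fp(1)]]) measurable
  moreover have "AE \<xi> in lborel. \<forall>j. \<xi> \<in> torus \<longrightarrow> cmod (\<Phi> (\<xi> + ?t j)) \<le> a j"
    unfolding a_def by (subst AE_all_countable) (intro allI AE_le_loc_sup afin)
  \<comment> \<open>A single null set handles all j at once, and periodicity of the sum makes the
    one value \<open>Q \<xi>\<close> valid at every translate of \<xi>.\<close>
  ultimately have good: "AE \<xi> in lborel. \<xi> \<in> torus \<longrightarrow> (\<forall>j. cmod (\<Phi> (\<xi> + ?t j)) \<le> a j \<and> ?P (\<xi> + ?t j) = complex_of_real (Q \<xi>))"
    using c(2)
  proof eventually_elim
    case (elim \<xi>)
    show ?case
    proof (intro impI allI conjI)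
      fix j assume T: "\<xi> \<in> torus"
      show "cmod (\<Phi> (\<xi> + ?t j)) \<le> a j" using elim T by blast
      let ?r = "\<lambda>j. Re (\<Phi> (\<xi> + ?t j))"
      have r: "\<Phi> (\<xi> + ?t j) = complex_of_real (?r j)" "0 \<le> ?r j" "?r j \<le> a j" for j
      proof -
        show 1: "\<Phi> (\<xi> + ?t j) = complex_of_real (?r j)" "0 \<le> ?r j" using elim by blast+
        show "?r j \<le> a j" using elim T complex_Re_le_cmod[of "\<Phi> (\<xi> + ?t j)"] order_trans by blast
      qed
      have "(\<lambda>j. norm (?r j)) summable_on UNIV"
        using r by (intro Infinite_Sum.abs_summable_on_comparison_test'[OF asum]) auto
      then have rs: "?r summable_on UNIV" by (rule abs_summable_summable)
      have P: "((\<lambda>j. \<Phi> (\<xi> + ?t j)) has_sum complex_of_real (infsum ?r UNIV)) UNIV"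
        by (subst r(1)) (intro has_sum_of_real has_sum_infsum rs)
      \<comment> \<open>By nonnegativity the term j = 0 equals its modulus, which is at least c on
        the torus; the other nonnegative terms can only increase the sum.\<close>
      have "c \<le> ?r 0"
        using elim(3) T r(1,2)[of 0] by (metis abs_of_nonneg add.right_neutral mult_zero_right norm_of_real of_int_0)
      also have "?r 0 \<le> infsum ?r UNIV"
        using finite_sum_le_infsum[OF rs, of "{0}"] r(2) by simp
      finally have lo: "c \<le> infsum ?r UNIV" .
      have hi: "infsum ?r UNIV \<le> A"
        unfolding A_def by (intro infsum_mono rs asum r)
      have "((\<lambda>n. \<Phi> (\<xi> + ?t (int_decode n))) has_sum complex_of_real (infsum ?r UNIV)) UNIV"
        using P has_sum_reindex_bij_betw[OF bij_int_decode, of "\<lambda>j. \<Phi> (\<xi> + ?t j)"] by simp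
      then have "(\<Sum>n. \<Phi> (\<xi> + ?t (int_decode n))) = complex_of_real (infsum ?r UNIV)"
        by (intro sums_unique[symmetric] has_sum_imp_sums)
      then have "Q \<xi> = infsum ?r UNIV" using lo hi by (simp add: Q_def)
      then show "?P (\<xi> + ?t j) = complex_of_real (Q \<xi>)"
        unfolding infsum_translates_periodic using infsumI[OF P] by simp
    qed
  qed
  have M: "?M \<eta> = \<Phi> \<eta> / complex_of_real (s * Q \<xi>)" if "?P \<eta> = complex_of_real (Q \<xi>)" for \<eta> \<xi>
    using that by (simp add: s_def)
  \<comment> \<open>Here \<open>\<Phi>\<close> is \<open>?M\<close> times s Q, so the error
    \<open>\<Phi>\<close> - z \<open>?M\<close> equals \<open>?M\<close> (s Q - z). The constant 1 /
    (s c) arises because |\<open>?M\<close>| is at most a j / (s c), by Q \<ge> c.\<close>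
  have 1: "shift_closure L \<phi>"
  proof (rule shift_closure_of_fourier_multiplier[OF fp, where q="\<lambda>\<xi>. s * Q \<xi>" and B="s * max c A" and b=a and D="1 / (s * c)"])
    show "\<bar>s * Q x\<bar> \<le> s * max c A" for x
      using s Q0[of x] QB[of x] by (simp add: abs_mult)
    show "0 \<le> 1 / (s * c)" using s c by simp
    show "AE \<xi> in lborel. \<xi> \<in> torus \<longrightarrow> (\<forall>j z. cmod (\<Phi> (\<xi> + ?t j) - z * ?M (\<xi> + ?t j))
        \<le> 1 / (s * c) * a j * cmod (complex_of_real (s * Q \<xi>) - z))"
      using good
    proof eventually_elim
      case (elim \<xi>)
      show ?case
      proof (intro impI allI)
        fix j z assume "\<xi> \<in> torus"
        with elim have e: "cmod (\<Phi> (\<xi> + ?t j)) \<le> a j" "?P (\<xi> + ?t j) = complex_of_real (Q \<xi>)" by blast+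
        have sQ: "0 < s * c" "s * c \<le> s * Q \<xi>" using s c Qc[of \<xi>] by auto
        have "\<Phi> (\<xi> + ?t j) - z * ?M (\<xi> + ?t j) = \<Phi> (\<xi> + ?t j) / complex_of_real (s * Q \<xi>) * (complex_of_real (s * Q \<xi>) - z)"
          unfolding M[OF e(2)] using s Q0[of \<xi>] by (simp add: field_simps)
        also have "cmod \<dots> = cmod (\<Phi> (\<xi> + ?t j)) / (s * Q \<xi>) * cmod (complex_of_real (s * Q \<xi>) - z)"
          using sQ by (simp only: norm_mult norm_divide norm_of_real)
        also have "\<dots> \<le> a j / (s * c) * cmod (complex_of_real (s * Q \<xi>) - z)"
          using sQ e(1) order_trans[OF norm_ge_zero e(1)] by (intro mult_right_mono frac_le) auto
        finally show "cmod (\<Phi> (\<xi> + ?t j) - z * ?M (\<xi> + ?t j)) \<le> 1 / (s * c) * a j * cmod (complex_of_real (s * Q \<xi>) - z)"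
          by simp
      qed
    qed
  qed (use asum in measurable)
  \<comment> \<open>Conversely \<open>?M\<close> is \<open>\<Phi>\<close> times 1 / (s Q), so the
    error factors through \<open>\<Phi>\<close>, which is bounded by a j itself; hence D = 1, while
    the lower bound on Q keeps the multiplier bounded.\<close>
  have 2: "shift_closure \<phi> L"
  proof (rule shift_closure_of_fourier_multiplier[OF fp(2,1), where q="\<lambda>\<xi>. 1 / (s * Q \<xi>)" and B="1 / (s * c)" and b=a and D=1])
    show "\<bar>1 / (s * Q x)\<bar> \<le> 1 / (s * c)" for x
      using s Q0[of x] Qc[of x] c by (simp add: abs_mult frac_le)
    show "AE \<xi> in lborel. \<xi> \<in> torus \<longrightarrow> (\<forall>j z. cmod (?M (\<xi> + ?t j) - z * \<Phi> (\<xi> + ?t j))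
        \<le> 1 * a j * cmod (complex_of_real (1 / (s * Q \<xi>)) - z))"
      using good
    proof eventually_elim
      case (elim \<xi>)
      show ?case
      proof (intro impI allI)
        fix j z assume "\<xi> \<in> torus"
        with elim have e: "cmod (\<Phi> (\<xi> + ?t j)) \<le> a j" "?P (\<xi> + ?t j) = complex_of_real (Q \<xi>)" by blast+
        have "?M (\<xi> + ?t j) - z * \<Phi> (\<xi> + ?t j) = \<Phi> (\<xi> + ?t j) * (complex_of_real (1 / (s * Q \<xi>)) - z)"
          unfolding M[OF e(2)] by (simp add: algebra_simps)
        also have "cmod \<dots> \<le> a j * cmod (complex_of_real (1 / (s * Q \<xi>)) - z)"
          unfolding norm_mult by (intro mult_right_mono e) auto
        finally show "cmod (?M (\<xi> + ?t j) - z * \<Phi> (\<xi> + ?t j)) \<le> 1 * a j * cmod (complex_of_real (1 / (s * Q \<xi>)) - z)"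
          by simp
      qed
    qed
  qed (use asum in \<open>auto\<close>)
  show ?thesis
    using A1_L2 L_def 1 2 by (intro V_int_eqI) (auto simp: l2_fourier_def)
qed

end
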